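(* Let $(X_t)_{t\ge 0}$ be an irreducible, nonexplosive birth--death process on $\mathbb{N}$ with birth rates $\lambda$, death rates $\nu$ and semigroup $(P_t)_{t\ge0}$. Let $\mathcal{I}\subset\mathbb{R}$ be an open interval and $\varphi:\mathcal{I}\to\mathbb{R}$ a smooth convex function such that $\varphi''>0$ and $-1/\varphi''$ is convex on $\mathcal{I}$. If $\lambda$ is nonincreasing and $\nu$ is nondecreasing, then for any function $f:\mathbb{N}\to\mathcal{I}$ such that $\sup_{y\in\mathbb{N}}|\partial f(y)|<\infty$ and for any $t\ge0$, $$B^\varphi(P_tf,\partial P_tf)\le P_{1,t}^{V_1}B^\varphi(f,\partial f)$$ pointwise on $\mathbb{N}$, where the nonnegative potential is $V_1=\partial(\nu-\lambda)$.
   Context: $\mathbb{N}=\{0,1,2,\dots\}$. A birth--death process $(X_t)_{t\ge0}$ with birth rates $\lambda_x$ and death rates $\nu_x$ is the continuous-time Markov chain on $\mathbb{N}$ with generator $\mathcal{L}f(x)=\lambda_x\,\partial f(x)+\nu_x\,\partial^* f(x)$, where $\partial f(x)=f(x+1)-f(x)$, $\partial^*f(x)=f(x-1)-f(x)$; its semigroup is $P_tf(x)=\mathbb{E}_x[f(X_t)]$. Irreducible means $\lambda_x>0$ for all $x\in\mathbb{N}$, $\nu_x>0$ for all $x\ge1$ and $\nu_0=0$. Nonexplosive means $\sum_{x\ge1}\left(\frac1{\lambda_x}+\frac{\nu_x}{\lambda_x\lambda_{x-1}}+\cdots+\frac{\nu_x\cdots\nu_1}{\lambda_x\cdots\lambda_1\lambda_0}\right)=\infty$.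 The $1$-modification $(X_{1,t})_{t\ge0}$ is the birth--death process with birth rates $\lambda^1_x=\lambda_{x+1}$ and death rates $\nu^1_x=\nu_x$, with semigroup $P_{1,t}g(x)=\mathbb{E}_x[g(X_{1,t})]$, and $P_{1,t}^{V_1}g(x)=\mathbb{E}_x\left[g(X_{1,t})\exp\left(-\int_0^tV_1(X_{1,s})\,ds\right)\right]$ with $V_1(x)=\nu_{x+1}-\nu_x+\lambda_x-\lambda_{x+1}$. On $\mathcal{A}_{\mathcal{I}}=\{(r,s)\in\mathbb{R}^2:(r,r+s)\in\mathcal{I}\times\mathcal{I}\}$ define the nonnegative function $B^\varphi(r,s)=(\varphi'(r+s)-\varphi'(r))\,s$. Standing assumption: $\lambda^1$, $\nu^1$ and $V_1$ are $P_{1,t}$-integrable, i.e. $P_{1,t}(\lambda^1+\nu^1+|V_1|)(x)<\infty$ for all $x\in\mathbb{N}$, $t\ge0$. *)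

theory Defs
  imports "HOL-Probability.Probability"
begin

definition fdiff :: "(nat \<Rightarrow> real) \<Rightarrow> nat \<Rightarrow> real" where
  "fdiff f x = f (x + 1) - f x"

text \<open>At \<open>x = 0\<close> the truncated subtraction gives the value \<open>0\<close>. In the generator this
  term is multiplied by the death rate at \<open>0\<close>, which is \<open>0\<close>.\<close>

definition bdiff :: "(nat \<Rightarrow> real) \<Rightarrow> nat \<Rightarrow> real" where
  "bdiff f x = f (x - 1) - f x"

definition generator :: "(nat \<Rightarrow> real) \<Rightarrow> (nat \<Rightarrow> real) \<Rightarrow> (nat \<Rightarrow> real) \<Rightarrow> nat \<Rightarrow> real" where
  "generator lam \<nu> f x = lam x * fdiff f x + \<nu> x * bdiff f x"


text \<open>A process is a family \<open>P x\<close> of probability measures (the law under which the chain starts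
  at \<open>x\<close>) together with random variables \<open>X t\<close>; only times \<open>t \<ge> 0\<close> are meaningful.\<close>

definition past_events :: "(nat \<Rightarrow> 'a measure) \<Rightarrow> (real \<Rightarrow> 'a \<Rightarrow> nat) \<Rightarrow> nat \<Rightarrow> real \<Rightarrow> 'a set set" where
  "past_events P X x s =
     sigma_sets (space (P x)) {{\<omega> \<in> space (P x). X u \<omega> = n} | u n. 0 \<le> u \<and> u \<le> s}"

definition semigroup_of ::
    "(nat \<Rightarrow> 'a measure) \<Rightarrow> (real \<Rightarrow> 'a \<Rightarrow> nat) \<Rightarrow> real \<Rightarrow> (nat \<Rightarrow> real) \<Rightarrow> nat \<Rightarrow> real" where
  "semigroup_of P X t f x = (\<integral>\<omega>. f (X t \<omega>) \<partial>P x)"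

text \<open>The conditional form of \<open>markov\<close>, multiplied out, is
  \<open>P\<^sub>x(X\<^sub>s\<^sub>+\<^sub>t = z | A, X\<^sub>s = y) = P\<^sub>y(X\<^sub>t = z)\<close>.
  Limits of paths are taken in the discrete topology of \<^typ>\<open>nat\<close>, so that a path has
  finitely many jumps in bounded time.\<close>

locale markov_chain =
  fixes P :: "nat \<Rightarrow> 'a measure" and X :: "real \<Rightarrow> 'a \<Rightarrow> nat"
  assumes prob_space: "\<And>x. prob_space (P x)"
    and measurable_X: "\<And>x t. 0 \<le> t \<Longrightarrow> X t \<in> measurable (P x) (count_space UNIV)"
    and start: "\<And>x. AE \<omega> in P x. X 0 \<omega> = x"
    and right_continuous:
      "\<And>x \<omega> t. \<omega> \<in> space (P x) \<Longrightarrow> 0 \<le> t \<Longrightarrow> continuous (at_right t) (\<lambda>s. X s \<omega>)"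
    and left_limits:
      "\<And>x \<omega> t. \<omega> \<in> space (P x) \<Longrightarrow> 0 < t \<Longrightarrow> \<exists>n. ((\<lambda>s. X s \<omega>) \<longlongrightarrow> n) (at_left t)"
    and markov:
      "\<And>x s t A y z. 0 \<le> s \<Longrightarrow> 0 \<le> t \<Longrightarrow> A \<in> past_events P X x s \<Longrightarrow>
         measure (P x) {\<omega> \<in> A. X s \<omega> = y \<and> X (s + t) \<omega> = z}
         = measure (P x) {\<omega> \<in> A. X s \<omega> = y} * measure (P y) {\<omega> \<in> space (P y). X t \<omega> = z}"

text \<open>Taking for \<open>f\<close> the indicators of points, the last condition says that the transition
  probabilities have the rate matrix of \<^const>\<open>generator\<close> as derivative at time \<open>0\<close>.\<close>

locale birth_death_process = markov_chain P X
  for lam \<nu> :: "nat \<Rightarrow> real"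
    and P :: "nat \<Rightarrow> 'a measure" and X :: "real \<Rightarrow> 'a \<Rightarrow> nat" +
  assumes generator:
    "\<And>f x. finite {y. f y \<noteq> 0} \<Longrightarrow>
       ((\<lambda>h. (semigroup_of P X h f x - f x) / h) \<longlongrightarrow> generator lam \<nu> f x) (at_right 0)"

definition irreducible_rates :: "(nat \<Rightarrow> real) \<Rightarrow> (nat \<Rightarrow> real) \<Rightarrow> bool" where
  "irreducible_rates lam \<nu> \<longleftrightarrow> (\<forall>x. lam x > 0) \<and> (\<forall>x\<ge>1. \<nu> x > 0) \<and> \<nu> 0 = 0"

text \<open>In the inner sum, \<open>k = x\<close> is the term \<open>1 / lam x\<close> and \<open>k = 0\<close> is the term
  \<open>(\<nu> x \<cdots> \<nu> 1) / (lam x \<cdots> lam 0)\<close>. The outer sum runs over \<open>x \<ge> 1\<close>.\<close>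

definition nonexplosive_rates :: "(nat \<Rightarrow> real) \<Rightarrow> (nat \<Rightarrow> real) \<Rightarrow> bool" where
  "nonexplosive_rates lam \<nu> \<longleftrightarrow>
     (\<Sum>n. let x = Suc n in
        ennreal (\<Sum>k\<le>x. (\<Prod>i\<in>{k<..x}. \<nu> i) / (\<Prod>i\<in>{k..x}. lam i))) = \<infinity>"


definition birth1 :: "(nat \<Rightarrow> real) \<Rightarrow> nat \<Rightarrow> real" where
  "birth1 lam x = lam (x + 1)"

definition death1 :: "(nat \<Rightarrow> real) \<Rightarrow> nat \<Rightarrow> real" where
  "death1 \<nu> x = \<nu> x"

definition potential1 :: "(nat \<Rightarrow> real) \<Rightarrow> (nat \<Rightarrow> real) \<Rightarrow> nat \<Rightarrow> real" where
  "potential1 lam \<nu> x = \<nu> (x + 1) - \<nu> x + lam x - lam (x + 1)"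

lemma potential1_eq_fdiff: "potential1 lam \<nu> = fdiff (\<lambda>x. \<nu> x - lam x)"
  by (auto simp: potential1_def fdiff_def)

lemma potential1_nonneg:
  assumes "decseq lam" "incseq \<nu>"
  shows "potential1 lam \<nu> x \<ge> 0"
  using decseq_SucD[OF assms(1), of x] incseq_SucD[OF assms(2), of x]
  by (simp add: potential1_def)

text \<open>The argument \<open>g\<close> is nonnegative and the value may be \<open>\<infinity>\<close>.\<close>

definition feynman_kac ::
    "(nat \<Rightarrow> 'a measure) \<Rightarrow> (real \<Rightarrow> 'a \<Rightarrow> nat) \<Rightarrow> (nat \<Rightarrow> real) \<Rightarrow> real
      \<Rightarrow> (nat \<Rightarrow> ennreal) \<Rightarrow> nat \<Rightarrow> ennreal" where
  "feynman_kac P X V t g x =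
     (\<integral>\<^sup>+\<omega>. g (X t \<omega>) * ennreal (exp (- (LINT s:{0..t}|lborel. V (X s \<omega>)))) \<partial>P x)"


definition smooth_on :: "real set \<Rightarrow> (real \<Rightarrow> real) \<Rightarrow> bool" where
  "smooth_on I \<phi> \<longleftrightarrow> (\<forall>n. \<forall>r\<in>I. (deriv ^^ n) \<phi> differentiable (at r))"

text \<open>Meaningful (and, for convex \<open>\<phi>\<close>, nonnegative) when \<open>r\<close> and \<open>r + s\<close> lie in the interval
  on which \<open>\<phi>\<close> is considered.\<close>

definition B_fun :: "(real \<Rightarrow> real) \<Rightarrow> real \<Rightarrow> real \<Rightarrow> real" where
  "B_fun \<phi> r s = (deriv \<phi> (r + s) - deriv \<phi> r) * s"

end

theory Submission
  imports Defs "HOL-Real_Asymp.Real_Asymp"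
begin

text \<open>
  Why the theorem holds. Run the chain from \<open>x + 1\<close> and from \<open>x\<close> in a monotone coupling in which
  the upper copy is always equal to the lower copy or exactly one step above it. While the
  copies differ, the lower one moves like the \<open>1\<close>-modification: from \<open>(y, y + 1)\<close> both jump up at rate
  \<open>lam (y + 1)\<close> and both jump down at rate \<open>\<nu> y\<close>; the excess rates
  \<open>lam y - lam (y + 1)\<close> and \<open>\<nu> (y + 1) - \<nu> y\<close> make the copies meet, so the pair is killed at the rate
  \<open>potential1 lam \<nu> y\<close>. Now \<open>K(a, b) = (\<phi>'(b) - \<phi>'(a)) (b - a)\<close> is jointly convex on \<open>I \<times> I\<close> and
  vanishes on the diagonal, and \<open>B(P\<^sub>tf, \<partial>P\<^sub>tf)(x) = K(P\<^sub>tf(x), P\<^sub>tf(x + 1))\<close>. Jensen's inequality under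
  the coupling bounds it by the expectation of \<open>K(f(Y), f(Y + 1))\<close> over the pairs that have not met,
  which is the Feynman-Kac expression.

  Only the law of the coupling at the fixed time \<open>t\<close> matters, and it can be written down without
  constructing a joint process. Its mass at \<open>(z, z + 1)\<close> has to be
  \<open>q z = P\<^sub>x\<^sub>+\<^sub>1(X\<^sub>t > z) - P\<^sub>x(X\<^sub>t > z)\<close>, and its mass at \<open>(z, z)\<close> is \<open>P\<^sub>x(X\<^sub>t = z) - q z\<close>. What has to be
  shown is
  \<^item> \<open>0 \<le> q z\<close> (\<open>expectation_mono_start\<close>),
  \<^item> \<open>q z \<le> P\<^sub>x(X\<^sub>t = z)\<close> (\<open>expectation_shift_start\<close>),
  \<^item> \<open>q z\<close> is at most the Feynman-Kac weight of the point \<open>z\<close>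
    (\<open>tail_increment_le_product_limit\<close> together with \<open>feynman_kac_ge_product_limit\<close>).

  Each of the three says that a bounded family of functions which solves a difference
  inequality for small time steps, with birth-death coefficients, and starts nonpositive stays
  nonpositive. The death rates may be unbounded, but the birth rates are at most \<open>lam 0\<close>, so the affine barrier
  \<open>x + 1 + lam 0 * s\<close> gives a maximum principle (\<open>discrete_maximum_principle\<close>). The difference
  inequalities come from the Markov property and the generator alone: as the generator acts
  at one point \<open>x\<close> on three values, the short-time expansion of \<open>P\<^sub>hu(x)\<close> is uniform over
  all \<open>u\<close> with the same bound (\<open>short_time_expansion\<close>). No time derivative is taken.

  The same maximum principle gives \<open>E\<^sub>x X\<^sub>t \<le> x + lam 0 * t\<close>. Hence a function with bounded increments is
  integrable, and \<open>P\<^sub>tf\<close> takes its values in \<open>I\<close>. The convexity of \<open>K\<close> is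
  \<open>increment_product_above_tangent\<close>, and \<open>Jensen_for_unit_step_coupling\<close> combines all of this.
\<close>

section \<open>A maximum principle for difference inequalities\<close>

text \<open>
  The barrier \<open>R\<close> is a supersolution of the scheme: the operator acts on the slope \<open>\<epsilon>\<close> of \<open>x\<close> with at
  most the birth rate, which the growth \<open>c\<close> in time pays for, and downward jumps lower it. The value
  \<open>\<epsilon> = M / (N + 2)\<close> is chosen so that at \<open>x = N + 1\<close>, just outside the window of the
  step inequality, the barrier is already above \<open>M\<close>. Under \<open>h * k x \<le> 1\<close> one step of the scheme is monotone.
\<close>

lemma discrete_maximum_principle:
  fixes W :: "nat \<Rightarrow> nat \<Rightarrow> real" and b d k :: "nat \<Rightarrow> real"
  assumes nonneg: "0 \<le> h" "0 \<le> M" "0 \<le> \<eta>"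
    and b: "\<And>x. 0 \<le> b x" "\<And>x. b x \<le> c" and d: "\<And>x. 0 \<le> d x"
    and k: "\<And>x. b x + d x \<le> k x"
    and small: "\<And>x. x \<le> N \<Longrightarrow> h * k x \<le> 1"
    and init: "\<And>x. W 0 x \<le> 0"
    and bound: "\<And>i x. i \<le> n \<Longrightarrow> W i x \<le> M"
    and step: "\<And>i x. i < n \<Longrightarrow> x \<le> N \<Longrightarrow>
      W (Suc i) x \<le> W i x + h * (b x * W i (x + 1) + d x * W i (x - 1) - k x * W i x) + h * \<eta>"
  shows "i \<le> n \<Longrightarrow> x \<le> N + 1 \<Longrightarrow>
    W i x \<le> M / (real N + 2) * (real x + 1 + c * (real i * h)) + real i * h * \<eta>"
proof (induction i arbitrary: x)
  case 0
  have "0 \<le> M / (real N + 2) * (real x + 1)"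
    using nonneg by simp
  then show ?case using init[of x] by simp
next
  case (Suc i)
  define \<epsilon> where "\<epsilon> = M / (real N + 2)"
  define R where "R y = \<epsilon> * (real y + 1 + c * (real i * h)) + real i * h * \<eta>" for y
  have \<epsilon>: "0 \<le> \<epsilon>" "\<epsilon> * (real N + 2) = M" using nonneg by (auto simp: \<epsilon>_def)
  have c: "0 \<le> c" using b[of 0] by linarith
  have IH: "W i y \<le> R y" if "y \<le> N + 1" for y
    using Suc.IH[of y] Suc.prems that by (simp add: R_def \<epsilon>_def)
  have R0: "0 \<le> R y" for y
    using \<epsilon> c nonneg by (auto simp: R_def intro!: add_nonneg_nonneg mult_nonneg_nonneg)
  have goal: "M / (real N + 2) * (real x + 1 + c * (real (Suc i) * h)) + real (Suc i) * h * \<eta>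
      = R x + h * (c * \<epsilon>) + h * \<eta>"
    by (simp add: R_def \<epsilon>_def[symmetric] algebra_simps)
  show ?case
  proof (cases "x \<le> N")
    case False
    then have x: "x = N + 1" using Suc.prems by simp
    have "W (Suc i) x \<le> M" using bound Suc.prems by simp
    also have "M \<le> R x"
      using \<epsilon> c nonneg by (auto simp: R_def x algebra_simps intro!: add_nonneg_nonneg mult_nonneg_nonneg)
    also have "R x \<le> R x + h * (c * \<epsilon>) + h * \<eta>"
      using \<epsilon> c nonneg by simp
    finally show ?thesis unfolding goal .
  next
    case True
    have "W (Suc i) x \<le> (1 - h * k x) * W i x + (h * b x) * W i (x + 1)
        + (h * d x) * W i (x - 1) + h * \<eta>"
      using step[of i x] Suc.prems True by (simp add: algebra_simps)
    also have "\<dots> \<le> (1 - h * k x) * R x + (h * b x) * R (x + 1) + (h * d x) * R x + h * \<eta>"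
    proof -
      have "R (x - 1) \<le> R x"
        unfolding R_def using \<epsilon> by (intro add_right_mono mult_left_mono) auto
      then have "W i (x - 1) \<le> R x" using IH[of "x - 1"] True by force
      then show ?thesis
        using IH[of x] IH[of "x + 1"] True small[of x] b d nonneg
        by (intro add_mono mult_left_mono mult_nonneg_nonneg order_refl) auto
    qed
    also have "R (x + 1) = R x + \<epsilon>" by (simp add: R_def algebra_simps)
    also have "(1 - h * k x) * R x + (h * b x) * (R x + \<epsilon>) + (h * d x) * R x + h * \<eta>
        = R x - h * ((k x - b x - d x) * R x) + h * (b x * \<epsilon>) + h * \<eta>"
      by (simp add: algebra_simps)
    also have "\<dots> \<le> R x + h * (c * \<epsilon>) + h * \<eta>"
    proof -
      have "0 \<le> h * ((k x - b x - d x) * R x)"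
        using k[of x] R0[of x] nonneg by (intro mult_nonneg_nonneg) auto
      moreover have "h * (b x * \<epsilon>) \<le> h * (c * \<epsilon>)"
        using b \<epsilon> nonneg by (intro mult_left_mono mult_right_mono) auto
      ultimately show ?thesis by linarith
    qed
    finally show ?thesis unfolding goal .
  qed
qed

text \<open>
  With the \<open>n\<close>-th family run at step \<open>t / n\<close>, take first the window \<open>N\<close> so large that the barrier is
  small at \<open>x\<close>, then \<open>n\<close> so large that the errors in this finite window are small. The errors need
  to vanish only pointwise in space.
\<close>

lemma maximum_principle_refining_steps:
  fixes W :: "nat \<Rightarrow> nat \<Rightarrow> nat \<Rightarrow> real" and b d k :: "nat \<Rightarrow> real" and \<eta> :: "nat \<Rightarrow> nat \<Rightarrow> real"
  assumes t: "0 \<le> t"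
    and b: "\<And>x. 0 \<le> b x" "\<And>x. b x \<le> c" and d: "\<And>x. 0 \<le> d x"
    and k: "\<And>x. b x + d x \<le> k x"
    and init: "\<And>n x. W n 0 x \<le> 0"
    and bound: "\<And>n i x. 0 < n \<Longrightarrow> i \<le> n \<Longrightarrow> W n i x \<le> M"
    and step: "\<And>n i x. i < n \<Longrightarrow>
      W n (Suc i) x \<le> W n i x
        + t / real n * (b x * W n i (x + 1) + d x * W n i (x - 1) - k x * W n i x) + t / real n * \<eta> x n"
    and \<eta>: "\<And>x. \<eta> x \<longlonglongrightarrow> 0"
    and e: "0 < e"
  shows "\<forall>\<^sub>F n in sequentially. W n n x \<le> e"
proof -
  define K where "K = max M 0 * (real x + 1 + c * t)"
  have K: "((\<lambda>N. K / (real N + 2)) \<longlongrightarrow> 0) sequentially"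
    by real_asymp
  have "\<forall>\<^sub>F N in sequentially. K / (real N + 2) < e / 2"
    using order_tendstoD(2)[OF K, of "e / 2"] e by simp
  then obtain N where N: "K / (real N + 2) < e / 2" "x \<le> N"
    using eventually_conj[OF _ eventually_ge_at_top[of x]] eventually_happens'[OF sequentially_bot]
    by (metis (mono_tags, lifting))
  define E where "E n = (\<Sum>y\<le>N. \<bar>\<eta> y n\<bar>)" for n
  have "E \<longlonglongrightarrow> (\<Sum>y\<le>N. \<bar>0\<bar>)"
    unfolding E_def by (intro tendsto_intros \<eta>)
  then have "(\<lambda>n. t * E n) \<longlonglongrightarrow> t * 0"
    by (intro tendsto_intros) simp
  then have ev1: "\<forall>\<^sub>F n in sequentially. t * E n < e / 2"
    using order_tendstoD(2)[of "\<lambda>n. t * E n" "t * 0" sequentially "e / 2"] e by simp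
  have "\<forall>\<^sub>F n in sequentially. t / real n * k y < 1" for y
  proof (rule order_tendstoD(2))
    show "(\<lambda>n. t / real n * k y) \<longlonglongrightarrow> 0 * k y"
      by (intro tendsto_intros)
  qed simp
  then have ev2: "\<forall>\<^sub>F n in sequentially. \<forall>y\<in>{..N}. t / real n * k y < 1"
    by (intro eventually_ball_finite) auto
  show ?thesis
    using ev1 ev2 eventually_gt_at_top[of 0]
  proof eventually_elim
    case (elim n)
    have "W n n x \<le> max M 0 / (real N + 2) * (real x + 1 + c * (real n * (t / real n)))
        + real n * (t / real n) * E n"
    proof (rule discrete_maximum_principle[where W = "W n" and i = n and h = "t / real n" and \<eta> = "E n" and M = "max M 0" and c = c
          and b = b and d = d and k = k and n = n and N = N])
      show "W n (Suc i) y \<le> W n i y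
        + t / real n * (b y * W n i (y + 1) + d y * W n i (y - 1) - k y * W n i y) + t / real n * E n"
        if "i < n" "y \<le> N" for i y
      proof -
        have "\<eta> y n \<le> \<bar>\<eta> y n\<bar>" by simp
        also have "\<dots> \<le> E n"
          unfolding E_def using that by (intro member_le_sum) auto
        finally have "t / real n * \<eta> y n \<le> t / real n * E n"
          using t by (intro mult_left_mono) auto
        then show ?thesis using step[OF that(1), of y] by linarith
      qed
      show "0 \<le> E n" unfolding E_def by (intro sum_nonneg) auto
      show "W n i y \<le> max M 0" if "i \<le> n" for i y
        using bound[OF _ that, of y] elim by linarith
    qed (use t b d k init elim N in \<open>simp_all add: less_imp_le\<close>)
    also have "\<dots> = K / (real N + 2) + t * E n"
      using elim by (simp add: K_def)
    also have "\<dots> \<le> e" using elim N by linarith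
    finally show ?case .
  qed
qed

lemma maximum_principle:
  fixes W :: "real \<Rightarrow> nat \<Rightarrow> real" and b d k :: "nat \<Rightarrow> real" and \<eta> :: "nat \<Rightarrow> real \<Rightarrow> real"
  assumes t: "0 \<le> t"
    and b: "\<And>x. 0 \<le> b x" "\<And>x. b x \<le> c" and d: "\<And>x. 0 \<le> d x"
    and k: "\<And>x. b x + d x \<le> k x"
    and init: "\<And>x. W 0 x \<le> 0"
    and bound: "\<And>s x. 0 \<le> s \<Longrightarrow> W s x \<le> M"
    and step: "\<And>s h x. 0 \<le> s \<Longrightarrow> 0 \<le> h \<Longrightarrow>
      W (s + h) x \<le> W s x + h * (b x * W s (x + 1) + d x * W s (x - 1) - k x * W s x) + h * \<eta> x h"
    and \<eta>: "\<And>x. (\<eta> x \<longlongrightarrow> 0) (at_right 0)"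
  shows "W t x \<le> 0"
proof (cases "t = 0")
  case True
  then show ?thesis using init by simp
next
  case False
  then have t: "0 < t" using t by simp
  have "W t x \<le> e" if "0 < e" for e
  proof -
    have "\<forall>\<^sub>F n in sequentially. W (real n * (t / real n)) x \<le> e"
    proof (rule maximum_principle_refining_steps[where W = "\<lambda>n i. W (real i * (t / real n))"
          and b = b and d = d and k = k and t = t and \<eta> = "\<lambda>y n. \<eta> y (t / real n)" and M = M and c = c])
      fix y
      have "filterlim (\<lambda>n. t / real n) (at_right 0) sequentially"
        using t by real_asymp
      from filterlim_compose[OF \<eta> this]
      show "(\<lambda>n. \<eta> y (t / real n)) \<longlonglongrightarrow> 0" .
    next
      show "W (real (Suc i) * (t / real n)) y \<le> W (real i * (t / real n)) y
        + t / real n * (b y * W (real i * (t / real n)) (y + 1) + d y * W (real i * (t / real n)) (y - 1)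
           - k y * W (real i * (t / real n)) y) + t / real n * \<eta> y (t / real n)" for i n y
        using step[of "real i * (t / real n)" "t / real n" y] t
        by (simp add: add_divide_distrib algebra_simps)
    qed (use t b d k init bound that in auto)
    moreover have "\<forall>\<^sub>F n in sequentially. real n * (t / real n) = t"
      using eventually_gt_at_top[of 0] by eventually_elim simp
    ultimately have "\<forall>\<^sub>F n in sequentially. W t x \<le> e"
      by eventually_elim simp
    then show ?thesis by simp
  qed
  then show ?thesis by (rule field_le_epsilon[where y = "0::real", simplified])
qed

section \<open>Joint convexity of the increment product\<close>

text \<open>
  Let \<open>K = 1 / G u\<close> and \<open>L = 1 / G v\<close>. In the variables \<open>p = G v * \<beta>\<close>, \<open>r = G u * \<alpha>\<close> the second derivative of
  \<open>(F b - F a) * (b - a)\<close> in direction \<open>(\<alpha>, \<beta>)\<close> contains \<open>H / G\<^sup>2\<close>, the derivative of \<open>- 1 / G\<close>. The two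
  tangent inequalities for the convex function \<open>- 1 / G\<close> between \<open>u\<close> and \<open>v\<close> bound it below by
  \<open>(K + L) * (p - r)\<^sup>2\<close>.
\<close>

lemma increment_product_above_tangent:
  fixes F G H :: "real \<Rightarrow> real"
  assumes I: "open I" "is_interval I"
    and F: "\<And>r. r \<in> I \<Longrightarrow> (F has_real_derivative G r) (at r)"
    and G: "\<And>r. r \<in> I \<Longrightarrow> (G has_real_derivative H r) (at r)"
    and pos: "\<And>r. r \<in> I \<Longrightarrow> 0 < G r"
    and conv: "convex_on I (\<lambda>r. - 1 / G r)"
    and in_I: "a0 \<in> I" "b0 \<in> I" "a \<in> I" "b \<in> I"
  shows "(F b0 - F a0) * (b0 - a0)
      - (G a0 * (b0 - a0) + (F b0 - F a0)) * (a - a0)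
      + (G b0 * (b0 - a0) + (F b0 - F a0)) * (b - b0)
    \<le> (F b - F a) * (b - a)"
proof -
  define \<alpha> \<beta> where "\<alpha> = a - a0" and "\<beta> = b - b0"
  define A B where "A \<tau> = a0 + \<tau> * \<alpha>" and "B \<tau> = b0 + \<tau> * \<beta>" for \<tau>
  define h where "h \<tau> = (F (B \<tau>) - F (A \<tau>)) * (B \<tau> - A \<tau>)" for \<tau>
  define h1 where "h1 \<tau> = (G (B \<tau>) * \<beta> - G (A \<tau>) * \<alpha>) * (B \<tau> - A \<tau>)
      + (F (B \<tau>) - F (A \<tau>)) * (\<beta> - \<alpha>)" for \<tau>
  define h2 where "h2 \<tau> = (H (B \<tau>) * \<beta>\<^sup>2 - H (A \<tau>) * \<alpha>\<^sup>2) * (B \<tau> - A \<tau>)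
      + 2 * (G (B \<tau>) * \<beta> - G (A \<tau>) * \<alpha>) * (\<beta> - \<alpha>)" for \<tau>
  have convex: "convex I" using I is_interval_convex by blast
  have AB: "A \<tau> \<in> I" "B \<tau> \<in> I" if "\<tau> \<in> {0..1}" for \<tau>
  proof -
    have "(1 - \<tau>) *\<^sub>R a0 + \<tau> *\<^sub>R a \<in> I" "(1 - \<tau>) *\<^sub>R b0 + \<tau> *\<^sub>R b \<in> I"
      using that in_I convexD[OF convex] by auto
    then show "A \<tau> \<in> I" "B \<tau> \<in> I"
      by (simp_all add: A_def B_def \<alpha>_def \<beta>_def algebra_simps)
  qed
  have dA: "(A has_real_derivative \<alpha>) (at \<tau>)" and dB: "(B has_real_derivative \<beta>) (at \<tau>)" for \<tau>
    unfolding A_def[abs_def] B_def[abs_def] by (auto intro!: derivative_eq_intros)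
  have dh: "(h has_real_derivative h1 \<tau>) (at \<tau>)" if "\<tau> \<in> {0..1}" for \<tau>
    unfolding h_def[abs_def] h1_def
    using AB[OF that]
    by (auto intro!: derivative_eq_intros dA dB DERIV_chain2[OF F] simp: algebra_simps)
  have dh1: "(h1 has_real_derivative h2 \<tau>) (at \<tau>)" if "\<tau> \<in> {0..1}" for \<tau>
    unfolding h1_def[abs_def] h2_def
    using AB[OF that]
    by (auto intro!: derivative_eq_intros dA dB DERIV_chain2[OF F] DERIV_chain2[OF G]
        simp: algebra_simps power2_eq_square)
  have h2: "0 \<le> h2 \<tau>" if "\<tau> \<in> {0..1}" for \<tau>
  proof -
    define u v where "u = A \<tau>" and "v = B \<tau>"
    have uv: "u \<in> I" "v \<in> I" using AB[OF that] by (auto simp: u_def v_def)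
    have tangent: "H c / (G c)\<^sup>2 * (y - c) \<le> 1 / G c - 1 / G y" if "c \<in> I" "y \<in> I" for c y
    proof -
      have "((\<lambda>r. - 1 / G r) has_real_derivative H c / (G c)\<^sup>2) (at c within I)"
        using G[OF that(1)] pos[OF that(1)]
        by (auto intro!: derivative_eq_intros simp: power2_eq_square intro: has_field_derivative_at_within)
      then have "- 1 / G y - (- 1 / G c) \<ge> H c / (G c)\<^sup>2 * (y - c)"
        using that I conv convex
        by (intro convex_on_imp_above_tangent) (auto simp: interior_open convex_connected)
      then show ?thesis by simp
    qed
    define p r where "p = G v * \<beta>" and "r = G u * \<alpha>"
    define K L where "K = 1 / G u" and "L = 1 / G v"
    have KL: "0 < K" "0 < L" using pos uv by (auto simp: K_def L_def)
    have \<alpha>\<beta>: "\<alpha> = r * K" "\<beta> = p * L"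
      using pos[OF uv(1)] pos[OF uv(2)] by (auto simp: p_def r_def K_def L_def)
    define Hu Hv where "Hu = H u / (G u)\<^sup>2" and "Hv = H v / (G v)\<^sup>2"
    have "H v * \<beta>\<^sup>2 = Hv * p\<^sup>2" "H u * \<alpha>\<^sup>2 = Hu * r\<^sup>2"
      using pos[OF uv(1)] pos[OF uv(2)] by (auto simp: p_def r_def Hu_def Hv_def field_simps power2_eq_square)
    moreover have "\<beta> - \<alpha> = p * L - r * K" using \<alpha>\<beta> by simp
    ultimately have "h2 \<tau> = (Hv * p\<^sup>2 - Hu * r\<^sup>2) * (v - u) + 2 * (p - r) * (p * L - r * K)"
      unfolding h2_def u_def[symmetric] v_def[symmetric] p_def[symmetric] r_def[symmetric] by simp
    also have "\<dots> = p\<^sup>2 * (- (Hv * (u - v))) + r\<^sup>2 * (- (Hu * (v - u)))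
        + 2 * (p - r) * (p * L - r * K)"
      by (simp add: algebra_simps)
    finally have h2_eq: "h2 \<tau> = p\<^sup>2 * (- (Hv * (u - v))) + r\<^sup>2 * (- (Hu * (v - u)))
        + 2 * (p - r) * (p * L - r * K)" .
    have "p\<^sup>2 * (K - L) \<le> p\<^sup>2 * (- (Hv * (u - v)))" "r\<^sup>2 * (L - K) \<le> r\<^sup>2 * (- (Hu * (v - u)))"
      using tangent[OF uv] tangent[OF uv(2,1)]
      unfolding K_def[symmetric] L_def[symmetric] Hu_def[symmetric] Hv_def[symmetric]
      by (intro mult_left_mono; simp)+
    then have "p\<^sup>2 * (K - L) + r\<^sup>2 * (L - K) + 2 * (p - r) * (p * L - r * K) \<le> h2 \<tau>"
      unfolding h2_eq by linarith
    also have "p\<^sup>2 * (K - L) + r\<^sup>2 * (L - K) + 2 * (p - r) * (p * L - r * K) = (K + L) * (p - r)\<^sup>2"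
      by (simp add: power2_eq_square algebra_simps)
    finally have "(K + L) * (p - r)\<^sup>2 \<le> h2 \<tau>" .
    moreover have "0 \<le> (K + L) * (p - r)\<^sup>2" using KL by simp
    ultimately show ?thesis by linarith
  qed
  have "h1 0 * (1 - 0) \<le> h 1 - h 0"
    by (rule f''_imp_f'[where C = "{0..1}" and f'' = h2]) (use dh dh1 h2 in auto)
  then show ?thesis
    by (simp add: h_def h1_def A_def B_def \<alpha>_def \<beta>_def algebra_simps)
qed

lemma (in prob_space) expectation_in_open_interval:
  assumes I: "open I" "is_interval I" and X: "integrable M X" "\<And>\<omega>. \<omega> \<in> space M \<Longrightarrow> X \<omega> \<in> (I :: real set)"
  shows "expectation X \<in> I"
proof (rule ccontr)
  assume E: "expectation X \<notin> I"
  obtain \<omega> where \<omega>: "\<omega> \<in> space M" using not_empty by blast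
  have "(\<forall>r\<in>I. r < expectation X) \<or> (\<forall>r\<in>I. expectation X < r)"
    using E I(2) unfolding is_interval_1 by (metis linorder_not_le order_less_le)
  then show False
  proof
    assume "\<forall>r\<in>I. r < expectation X"
    then have "expectation X < expectation X"
      using X by (intro expectation_less) auto
    then show False by simp
  next
    assume "\<forall>r\<in>I. expectation X < r"
    then have "expectation X < expectation X"
      using X by (intro expectation_greater) auto
    then show False by simp
  qed
qed

section \<open>Transition laws of the chain and their short-time expansion\<close>

context markov_chain
begin

definition law :: "real \<Rightarrow> nat \<Rightarrow> nat pmf" where
  "law t x = Abs_pmf (distr (P x) (count_space UNIV) (X t))"

lemma measure_pmf_law:
  assumes "0 \<le> t"
  shows "measure_pmf (law t x) = distr (P x) (count_space UNIV) (X t)"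
proof -
  interpret P: prob_space "P x" by (rule prob_space)
  let ?D = "distr (P x) (count_space UNIV) (X t)"
  interpret D: prob_space ?D
    using measurable_X[OF assms] by (rule P.prob_space_distr)
  have "AE z in ?D. \<forall>y. z = y \<longrightarrow> measure ?D {y} \<noteq> 0"
    unfolding AE_all_countable
  proof
    fix y
    show "AE z in ?D. z = y \<longrightarrow> measure ?D {y} \<noteq> 0"
      by (cases "measure ?D {y} = 0") (auto simp: D.prob_eq_0 intro!: AE_I[of _ _ "{y}"] simp: D.emeasure_eq_measure)
  qed
  then have "AE z in ?D. measure ?D {z} \<noteq> 0" by simp
  then show ?thesis
    unfolding law_def using D.prob_space_axioms by (subst Abs_pmf_inverse) auto
qed

lemma nn_integral_law:
  "0 \<le> t \<Longrightarrow> (\<integral>\<^sup>+z. g z \<partial>law t x) = (\<integral>\<^sup>+\<omega>. g (X t \<omega>) \<partial>P x)"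
  using measurable_X by (simp add: measure_pmf_law nn_integral_distr)

lemma semigroup_eq_expectation_law:
  "0 \<le> t \<Longrightarrow> semigroup_of P X t f x = measure_pmf.expectation (law t x) f"
  using measurable_X by (simp add: semigroup_of_def measure_pmf_law integral_distr)

lemma pmf_law: "0 \<le> t \<Longrightarrow> pmf (law t x) z = measure (P x) {\<omega> \<in> space (P x). X t \<omega> = z}"
  using measurable_X
  by (simp add: pmf.rep_eq measure_pmf_law measure_distr vimage_def Int_def conj_commute)

lemma law_0: "law 0 x = return_pmf x"
proof (rule pmf_eqI)
  fix z
  interpret P: prob_space "P x" by (rule prob_space)
  have [measurable]: "X 0 \<in> measurable (P x) (count_space UNIV)"
    by (rule measurable_X) simp
  have "measure (P x) {\<omega> \<in> space (P x). X 0 \<omega> = x} = 1"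
    using start[of x] by (subst P.prob_Collect_eq_1) auto
  moreover have "measure (P x) {\<omega> \<in> space (P x). X 0 \<omega> = z} = 0" if "z \<noteq> x"
    using start[of x] that by (subst P.prob_Collect_eq_0) auto
  ultimately have "measure (P x) {\<omega> \<in> space (P x). X 0 \<omega> = z} = (if x = z then 1 else 0)"
    by auto
  then show "pmf (law 0 x) z = pmf (return_pmf x) z"
    by (simp add: pmf_law pmf_return indicator_def)
qed

text \<open>
  The past up to time \<open>s\<close> as a measure space, so that weights depending on the past can be treated
  as measurable functions.
\<close>

definition past :: "nat \<Rightarrow> real \<Rightarrow> 'a measure" where
  "past x s = sigma (space (P x)) {{\<omega> \<in> space (P x). X u \<omega> = n} | u n. 0 \<le> u \<and> u \<le> s}"

lemma space_past [simp]: "space (past x s) = space (P x)"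
  by (simp add: past_def space_measure_of_conv)

lemma sets_past: "sets (past x s) = past_events P X x s"
  unfolding past_def past_events_def by (subst sets_measure_of) auto

lemma sets_past_subset: "sets (past x s) \<subseteq> sets (P x)"
  unfolding sets_past past_events_def
proof (rule sets.sigma_sets_subset, safe)
  fix u :: real and n assume "0 \<le> u"
  then have [measurable]: "X u \<in> measurable (P x) (count_space UNIV)" by (rule measurable_X)
  show "{\<omega> \<in> space (P x). X u \<omega> = n} \<in> sets (P x)" by measurable
qed

lemma measurable_past: "Y \<in> borel_measurable (past x s) \<Longrightarrow> Y \<in> borel_measurable (P x)"
  by (rule borel_measurable_subalgebra[OF sets_past_subset]) simp_all

lemma measurable_X_past:
  assumes "0 \<le> u" "u \<le> s"
  shows "X u \<in> measurable (past x s) (count_space UNIV)"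
proof (subst measurable_count_space_eq_countable, simp, safe)
  fix n
  have "{\<omega> \<in> space (P x). X u \<omega> = n} \<in> past_events P X x s"
    unfolding past_events_def using assms by (intro sigma_sets.Basic) auto
  then show "X u -` {n} \<inter> space (past x s) \<in> sets (past x s)"
    unfolding sets_past by (simp add: vimage_def Int_def conj_commute)
qed auto

text \<open>
  The Markov hypothesis is given for single states. Both sides are countable sums over the state
  \<open>y\<close> at time \<open>s\<close> and the state \<open>z\<close> at time \<open>s + t\<close>.
\<close>

lemma markov_on_event:
  assumes s: "0 \<le> s" and t: "0 \<le> t" and A: "A \<in> sets (past x s)"
  shows "(\<integral>\<^sup>+\<omega>. indicator A \<omega> * g (X (s + t) \<omega>) \<partial>P x)
    = (\<integral>\<^sup>+\<omega>. indicator A \<omega> * (\<integral>\<^sup>+z. g z \<partial>law t (X s \<omega>)) \<partial>P x)"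
proof -
  interpret P: prob_space "P x" by (rule prob_space)
  have [measurable]: "A \<in> sets (P x)" using A sets_past_subset by auto
  have [measurable]: "X s \<in> measurable (P x) (count_space UNIV)"
     "X (s + t) \<in> measurable (P x) (count_space UNIV)"
    using s t by (auto intro!: measurable_X)
  have split: "{\<omega> \<in> A. X s \<omega> = y \<and> X (s + t) \<omega> = z} = A \<inter> {\<omega> \<in> space (P x). X s \<omega> = y \<and> X (s + t) \<omega> = z}"
    "{\<omega> \<in> A. X s \<omega> = y} = A \<inter> {\<omega> \<in> space (P x). X s \<omega> = y}" for y z
    using sets.sets_into_space[OF \<open>A \<in> sets (P x)\<close>] by auto
  have [measurable]: "{\<omega> \<in> A. X s \<omega> = y \<and> X (s + t) \<omega> = z} \<in> sets (P x)" "{\<omega> \<in> A. X s \<omega> = y} \<in> sets (P x)" for y z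
    unfolding split by measurable
  have joint: "emeasure (P x) {\<omega> \<in> A. X s \<omega> = y \<and> X (s + t) \<omega> = z}
      = emeasure (P x) {\<omega> \<in> A. X s \<omega> = y} * ennreal (pmf (law t y) z)" for y z
    using markov[OF s t, of A x y z] A
    by (simp add: P.emeasure_eq_measure sets_past pmf_law t ennreal_mult[symmetric])
  have "(\<integral>\<^sup>+\<omega>. indicator A \<omega> * g (X (s + t) \<omega>) \<partial>P x)
    = (\<integral>\<^sup>+\<omega>. (\<Sum>y. \<Sum>z. g z * indicator {\<omega> \<in> A. X s \<omega> = y \<and> X (s + t) \<omega> = z} \<omega>) \<partial>P x)"
  proof (rule nn_integral_cong)
    fix \<omega>
    have "(\<Sum>y. \<Sum>z. g z * indicator {\<omega> \<in> A. X s \<omega> = y \<and> X (s + t) \<omega> = z} \<omega>)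
      = (\<Sum>y. (\<Sum>z. g z * indicator {z} (X (s + t) \<omega>)) * indicator A \<omega> * indicator {y} (X s \<omega>))"
      by (intro suminf_cong) (auto simp: indicator_def)
    also have "\<dots> = (\<Sum>y. g (X (s + t) \<omega>) * indicator A \<omega> * indicator {y} (X s \<omega>))"
      by (subst suminf_cmult_indicator[where i = "X (s + t) \<omega>"]) (auto simp: disjoint_family_on_def)
    also have "\<dots> = g (X (s + t) \<omega>) * indicator A \<omega>"
      by (rule suminf_cmult_indicator) (auto simp: disjoint_family_on_def)
    finally show "indicator A \<omega> * g (X (s + t) \<omega>) = (\<Sum>y. \<Sum>z. g z * indicator {\<omega> \<in> A. X s \<omega> = y \<and> X (s + t) \<omega> = z} \<omega>)"
      by (simp add: mult.commute)
  qed
  also have "\<dots> = (\<Sum>y. \<Sum>z. g z * emeasure (P x) {\<omega> \<in> A. X s \<omega> = y \<and> X (s + t) \<omega> = z})"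
    by (simp add: nn_integral_suminf nn_integral_cmult_indicator)
  also have "\<dots> = (\<Sum>y. (\<Sum>z. ennreal (pmf (law t y) z) * g z) * emeasure (P x) {\<omega> \<in> A. X s \<omega> = y})"
    by (simp add: joint ac_simps flip: ennreal_suminf_multc)
  also have "\<dots> = (\<Sum>y. (\<integral>\<^sup>+z. g z \<partial>law t y) * emeasure (P x) {\<omega> \<in> A. X s \<omega> = y})"
    by (simp add: nn_integral_measure_pmf nn_integral_count_space_nat)
  also have "\<dots> = (\<integral>\<^sup>+\<omega>. (\<Sum>y. (\<integral>\<^sup>+z. g z \<partial>law t y) * indicator {\<omega> \<in> A. X s \<omega> = y} \<omega>) \<partial>P x)"
    by (simp add: nn_integral_suminf nn_integral_cmult_indicator)
  also have "\<dots> = (\<integral>\<^sup>+\<omega>. indicator A \<omega> * (\<integral>\<^sup>+z. g z \<partial>law t (X s \<omega>)) \<partial>P x)"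
  proof (rule nn_integral_cong)
    fix \<omega>
    have "(\<Sum>y. (\<integral>\<^sup>+z. g z \<partial>law t y) * indicator {\<omega> \<in> A. X s \<omega> = y} \<omega>)
      = (\<Sum>y. (\<integral>\<^sup>+z. g z \<partial>law t y) * indicator {y} (X s \<omega>)) * indicator A \<omega>"
      by (subst ennreal_suminf_multc[symmetric], intro suminf_cong) (auto simp: indicator_def)
    also have "\<dots> = (\<integral>\<^sup>+z. g z \<partial>law t (X s \<omega>)) * indicator A \<omega>"
      by (subst suminf_cmult_indicator[where i = "X s \<omega>"]) (auto simp: disjoint_family_on_def)
    finally show "(\<Sum>y. (\<integral>\<^sup>+z. g z \<partial>law t y) * indicator {\<omega> \<in> A. X s \<omega> = y} \<omega>)
       = indicator A \<omega> * (\<integral>\<^sup>+z. g z \<partial>law t (X s \<omega>))"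
      by (simp add: mult.commute)
  qed
  finally show ?thesis .
qed

lemma weighted_markov:
  assumes s: "0 \<le> s" and t: "0 \<le> t" and \<Phi>: "\<Phi> \<in> borel_measurable (past x s)"
  shows "(\<integral>\<^sup>+\<omega>. \<Phi> \<omega> * g (X (s + t) \<omega>) \<partial>P x)
    = (\<integral>\<^sup>+\<omega>. \<Phi> \<omega> * (\<integral>\<^sup>+z. g z \<partial>law t (X s \<omega>)) \<partial>P x)"
proof -
  have [measurable]: "X s \<in> measurable (P x) (count_space UNIV)"
     "X (s + t) \<in> measurable (P x) (count_space UNIV)"
    using s t by (auto intro!: measurable_X)
  have gX [measurable]: "(\<lambda>\<omega>. g (X (s + t) \<omega>)) \<in> borel_measurable (P x)"
    "(\<lambda>\<omega>. \<integral>\<^sup>+z. g z \<partial>law t (X s \<omega>)) \<in> borel_measurable (P x)"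
    by measurable
  show ?thesis
    using \<Phi>
  proof (induction rule: borel_measurable_induct)
    case (cong f g')
    have "(\<integral>\<^sup>+\<omega>. f \<omega> * h \<omega> \<partial>P x) = (\<integral>\<^sup>+\<omega>. g' \<omega> * h \<omega> \<partial>P x)" for h :: "'a \<Rightarrow> ennreal"
      using cong by (intro nn_integral_cong) auto
    then show ?case using cong by simp
  next
    case (set A)
    then show ?case using markov_on_event[OF s t] by simp
  next
    case (mult u c)
    from measurable_past[OF mult(2)] have [measurable]: "u \<in> borel_measurable (P x)" .
    from mult show ?case
      by (simp add: mult.assoc nn_integral_cmult)
  next
    case (add u v)
    from measurable_past[OF add(1)] measurable_past[OF add(3)]
    have [measurable]: "u \<in> borel_measurable (P x)" "v \<in> borel_measurable (P x)" .
    from add show ?case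
      by (simp add: distrib_right nn_integral_add)
  next
    case (seq U)
    have [measurable]: "U i \<in> borel_measurable (P x)" for i using seq by (auto intro: measurable_past)
    have "(\<integral>\<^sup>+\<omega>. (SUP i. U i) \<omega> * h \<omega> \<partial>P x) = (SUP i. \<integral>\<^sup>+\<omega>. U i \<omega> * h \<omega> \<partial>P x)"
      if [measurable]: "h \<in> borel_measurable (P x)" for h :: "'a \<Rightarrow> ennreal"
      unfolding SUP_apply SUP_mult_right_ennreal
      using seq by (intro nn_integral_monotone_convergence_SUP)
        (auto simp: incseq_def le_fun_def intro!: mult_right_mono)
    then show ?case using seq gX by simp
  qed
qed

lemma law_add:
  assumes "0 \<le> s" "0 \<le> t"
  shows "law (s + t) x = law s x \<bind> law t"
proof (rule pmf_eqI)
  fix z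
  have "ennreal (pmf (law (s + t) x) z) = (\<integral>\<^sup>+\<omega>. 1 * indicator {z} (X (s + t) \<omega>) \<partial>P x)"
    using assms by (simp add: emeasure_pmf_single[symmetric] nn_integral_law[symmetric])
  also have "\<dots> = (\<integral>\<^sup>+\<omega>. (\<integral>\<^sup>+z'. indicator {z} z' \<partial>law t (X s \<omega>)) \<partial>P x)"
    using assms by (subst weighted_markov) auto
  also have "\<dots> = ennreal (pmf (law s x \<bind> law t) z)"
    using assms by (simp add: ennreal_pmf_bind nn_integral_law emeasure_pmf_single)
  finally show "pmf (law (s + t) x) z = pmf (law s x \<bind> law t) z" by simp
qed

lemma expectation_law_add:
  fixes f :: "nat \<Rightarrow> real"
  assumes "0 \<le> s" "0 \<le> t" "\<And>y. \<bar>f y\<bar> \<le> M"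
  shows "measure_pmf.expectation (law (s + t) x) f
    = measure_pmf.expectation (law s x) (\<lambda>y. measure_pmf.expectation (law t y) f)"
  unfolding law_add[OF assms(1,2)] measure_pmf_bind
  by (rule integral_bind[where K = "count_space UNIV" and B = M and B' = 1])
    (use assms(3) measure_pmf.finite_measure in \<open>auto simp: space_subprob_algebra subprob_space_measure_pmf measure_pmf.emeasure_space_1\<close>)

end

lemma abs_expectation_pmf_le:
  fixes f :: "'a \<Rightarrow> real"
  assumes "\<And>y. \<bar>f y\<bar> \<le> M"
  shows "\<bar>measure_pmf.expectation p f\<bar> \<le> M"
proof -
  have int: "integrable (measure_pmf p) f"
    using assms by (intro measure_pmf.integrable_const_bound[where B = M]) auto
  have "\<bar>measure_pmf.expectation p f\<bar> \<le> measure_pmf.expectation p (\<lambda>y. \<bar>f y\<bar>)"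
    by (rule integral_abs_bound)
  also have "\<dots> \<le> M"
    using assms int by (intro measure_pmf.integral_le_const) auto
  finally show ?thesis .
qed

context birth_death_process
begin

definition neighbours :: "nat \<Rightarrow> nat set" where
  "neighbours x = {x - 1, x, x + 1}"

text \<open>
  The error per unit of time in replacing \<open>P\<^sub>hu(x)\<close> by \<open>u(x) + h * generator lam \<nu> u x\<close> when \<open>\<bar>u\<bar> \<le> 1\<close>:
  the defect of the generator limit at the three states reachable in one jump, and the
  probability of being anywhere else. It involves finitely many test functions, hence it
  vanishes as \<open>h\<close> tends to \<open>0\<close>.
\<close>

definition short_time_error :: "nat \<Rightarrow> real \<Rightarrow> real" where
  "short_time_error x h =
     (\<Sum>y\<in>neighbours x. \<bar>(semigroup_of P X h (indicator {y}) x - indicator {y} x) / h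
        - generator lam \<nu> (indicator {y}) x\<bar>)
     + (1 - semigroup_of P X h (indicator (neighbours x)) x) / h"

lemma short_time_error_tendsto_0: "(short_time_error x \<longlongrightarrow> 0) (at_right 0)"
proof -
  have "((\<lambda>h. (semigroup_of P X h (indicator {y}) x - indicator {y} x) / h
      - generator lam \<nu> (indicator {y}) x) \<longlongrightarrow> generator lam \<nu> (indicator {y}) x - generator lam \<nu> (indicator {y}) x)
       (at_right 0)" for y
    by (intro tendsto_diff generator tendsto_const) (simp add: indicator_def)
  then have 1: "((\<lambda>h. \<Sum>y\<in>neighbours x. \<bar>(semigroup_of P X h (indicator {y}) x - indicator {y} x) / h
        - generator lam \<nu> (indicator {y}) x\<bar>) \<longlongrightarrow> (\<Sum>y\<in>neighbours x. \<bar>0\<bar>)) (at_right 0)"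
    by (intro tendsto_intros) simp
  have fin: "finite {y. indicator (neighbours x) y \<noteq> (0::real)}"
    by (rule finite_subset[of _ "neighbours x"]) (auto simp: neighbours_def indicator_def)
  have "generator lam \<nu> (indicator (neighbours x)) x = 0"
    by (simp add: generator_def fdiff_def bdiff_def neighbours_def)
  then have "((\<lambda>h. - ((semigroup_of P X h (indicator (neighbours x)) x - indicator (neighbours x) x) / h))
      \<longlongrightarrow> - 0) (at_right 0)"
    using generator[OF fin, of x] by (intro tendsto_minus) simp
  then have "((\<lambda>h. (1 - semigroup_of P X h (indicator (neighbours x)) x) / h) \<longlongrightarrow> 0) (at_right 0)"
    by (simp add: neighbours_def diff_divide_distrib)
  from tendsto_add[OF 1 this] show ?thesis
    by (simp add: short_time_error_def[abs_def])
qed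

text \<open>
  Split \<open>u\<close> into its values at the neighbours of \<open>x\<close>, where indicators span everything, and the
  rest, whose contribution is at most \<open>M\<close> times the probability of leaving the neighbours.
  The error depends on \<open>u\<close> only through the bound \<open>M\<close>, so \<open>u\<close> may itself be \<open>P\<^sub>sf\<close>.
\<close>

lemma short_time_expansion:
  fixes u :: "nat \<Rightarrow> real"
  assumes h: "0 \<le> h" and M: "\<And>y. \<bar>u y\<bar> \<le> M"
  shows "\<bar>measure_pmf.expectation (law h x) u - u x - h * generator lam \<nu> u x\<bar>
    \<le> h * (M * short_time_error x h)"
proof (cases "h = 0")
  case True
  then show ?thesis by (simp add: law_0)
next
  case False
  then have h: "0 < h" using h by simp
  let ?N = "neighbours x" and ?E = "measure_pmf.expectation (law h x)"
  define a where "a y = (semigroup_of P X h (indicator {y}) x - indicator {y} x) / h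
        - generator lam \<nu> (indicator {y}) x" for y
  have M0: "0 \<le> M" using M[of 0] by linarith
  have fin: "finite ?N" by (simp add: neighbours_def)
  have int: "integrable (law h x) v" if "\<And>y. \<bar>v y\<bar> \<le> M" for v :: "nat \<Rightarrow> real"
    using that by (intro measure_pmf.integrable_const_bound[where B = M]) auto
  have "?E u = ?E (\<lambda>y. u y * indicator ?N y + u y * indicator (- ?N) y)"
    by (intro Bochner_Integration.integral_cong) (auto simp: indicator_def)
  also have "\<dots> = ?E (\<lambda>y. u y * indicator ?N y) + ?E (\<lambda>y. u y * indicator (- ?N) y)"
    using M M0 by (intro Bochner_Integration.integral_add int) (auto simp: indicator_def)
  finally have split: "?E u = ?E (\<lambda>y. u y * indicator ?N y) + ?E (\<lambda>y. u y * indicator (- ?N) y)" .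
  have far: "\<bar>?E (\<lambda>y. u y * indicator (- ?N) y)\<bar> \<le> M * (1 - ?E (indicator ?N))"
  proof -
    have "\<bar>?E (\<lambda>y. u y * indicator (- ?N) y)\<bar> \<le> ?E (\<lambda>y. \<bar>u y * indicator (- ?N) y\<bar>)"
      by (rule integral_abs_bound)
    also have "\<dots> \<le> ?E (\<lambda>y. M * indicator (- ?N) y)"
      using M M0 by (intro integral_mono int) (auto simp: indicator_def)
    also have "\<dots> = M * (1 - ?E (indicator ?N))"
      by (simp add: measure_pmf.prob_compl[of ?N, simplified] Compl_eq_Diff_UNIV)
    finally show ?thesis .
  qed
  have point: "semigroup_of P X h (indicator {y}) x = pmf (law h x) y" for y
    using h by (simp add: semigroup_eq_expectation_law pmf.rep_eq)
  have near: "?E (\<lambda>y. u y * indicator ?N y) = (\<Sum>y\<in>?N. pmf (law h x) y * u y)"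
    by (subst integral_measure_pmf[OF fin]) (auto simp: indicator_def)
  have gen: "generator lam \<nu> u x = (\<Sum>y\<in>?N. generator lam \<nu> (indicator {y}) x * u y)"
  proof -
    have "generator lam \<nu> u x = lam x * (u (x + 1) - u x) + \<nu> x * (u (x - 1) - u x)"
      by (simp add: generator_def fdiff_def bdiff_def)
    also have "\<dots> = (\<Sum>y\<in>?N. generator lam \<nu> (indicator {y}) x * u y)"
      by (cases x) (simp_all add: neighbours_def generator_def fdiff_def bdiff_def algebra_simps)
    finally show ?thesis .
  qed
  have ux: "u x = (\<Sum>y\<in>?N. indicator {y} x * u y)"
    using fin by (simp add: indicator_def if_distrib[of "\<lambda>r. r * _"] neighbours_def cong: if_cong)
  have "(\<Sum>y\<in>?N. pmf (law h x) y * u y) - u x - h * generator lam \<nu> u x = (\<Sum>y\<in>?N. (h * a y) * u y)"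
  proof -
    have "h * a y = pmf (law h x) y - indicator {y} x - h * generator lam \<nu> (indicator {y}) x" for y
      using h by (simp add: a_def point field_simps)
    then show ?thesis
      unfolding gen by (subst ux) (simp add: sum_distrib_left sum_subtractf[symmetric] left_diff_distrib mult.assoc)
  qed
  also have "\<bar>\<dots>\<bar> \<le> (\<Sum>y\<in>?N. (h * \<bar>a y\<bar>) * M)"
    using M h by (intro order_trans[OF sum_abs] sum_mono) (auto simp: abs_mult intro!: mult_mono)
  finally have "\<bar>?E (\<lambda>y. u y * indicator ?N y) - u x - h * generator lam \<nu> u x\<bar> \<le> (\<Sum>y\<in>?N. (h * \<bar>a y\<bar>) * M)"
    unfolding near .
  with far have "\<bar>?E u - u x - h * generator lam \<nu> u x\<bar> \<le> (\<Sum>y\<in>?N. (h * \<bar>a y\<bar>) * M) + M * (1 - ?E (indicator ?N))"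
    unfolding split by linarith
  also have "\<dots> = h * (M * short_time_error x h)"
    unfolding short_time_error_def a_def[symmetric]
    using h by (simp add: semigroup_eq_expectation_law sum_distrib_left sum_distrib_right field_simps)
  finally show ?thesis .
qed

lemma semigroup_step:
  fixes f :: "nat \<Rightarrow> real"
  assumes "0 \<le> s" "0 \<le> h" "\<And>y. \<bar>f y\<bar> \<le> M"
  defines "u \<equiv> \<lambda>s x. measure_pmf.expectation (law s x) f"
  shows "\<bar>u (s + h) x - u s x - h * generator lam \<nu> (u s) x\<bar> \<le> h * (M * short_time_error x h)"
proof -
  have "u (s + h) x = measure_pmf.expectation (law h x) (u s)"
    using expectation_law_add[OF assms(2,1,3)] by (simp add: u_def add.commute)
  moreover have "\<bar>u s y\<bar> \<le> M" for y
    unfolding u_def by (rule abs_expectation_pmf_le) (rule assms(3))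
  ultimately show ?thesis
    using short_time_expansion[OF assms(2), of "u s" M x] by simp
qed

end

section \<open>Product approximation of the Feynman-Kac expression\<close>

text \<open>
  Fatou's lemma for the step functions that take the value of \<open>v\<close> at the right end of each cell:
  these endpoints approach \<open>s\<close> from the right, so right-continuity gives pointwise convergence.
  If \<open>v\<close> is not integrable, the Lebesgue integral on the left is \<open>0\<close>, and the inequality still holds.
\<close>

lemma integral_le_liminf_right_endpoint_sums:
  fixes v :: "real \<Rightarrow> real"
  assumes t: "0 \<le> t" and v: "\<And>s. 0 \<le> v s"
    and cont: "\<And>s. 0 \<le> s \<Longrightarrow> continuous (at_right s) v"
  shows "ennreal (LINT s:{0..t}|lborel. v s)
    \<le> liminf (\<lambda>n. ennreal (\<Sum>i<n. t / real n * v (real (Suc i) * (t / real n))))"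
proof -
  \<comment> \<open>Open on the right, so that \<open>s\<close> lies strictly to the left of the right end of its cell.\<close>
  define S where "S n s = (\<Sum>i<n. ennreal (v (real (Suc i) * (t / real n)))
      * indicator {real i * (t / real n) ..< real (Suc i) * (t / real n)} s)" for n s
  have "ennreal (LINT s:{0..t}|lborel. v s) \<le> (\<integral>\<^sup>+s. ennreal (indicator {0..t} s *\<^sub>R v s) \<partial>lborel)"
  proof (cases "set_integrable lborel {0..t} v")
    case True
    then show ?thesis
      unfolding set_lebesgue_integral_def set_integrable_def
      using v by (subst nn_integral_eq_integral) auto
  next
    case False
    then show ?thesis
      by (simp add: set_lebesgue_integral_def set_integrable_def not_integrable_integral_eq)
  qed
  also have "\<dots> = (\<integral>\<^sup>+s. ennreal (v s) * indicator {0..<t} s \<partial>lborel)"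
  proof (rule nn_integral_cong_AE)
    show "AE s in lborel. ennreal (indicator {0..t} s *\<^sub>R v s) = ennreal (v s) * indicator {0..<t} s"
      using AE_lborel_singleton[of t] by eventually_elim (auto simp: indicator_def)
  qed
  also have "\<dots> \<le> (\<integral>\<^sup>+s. liminf (\<lambda>n. S n s) \<partial>lborel)"
  proof (rule nn_integral_mono)
    fix s
    have "ennreal (v s) \<le> liminf (\<lambda>n. S n s)" if s: "0 \<le> s" "s < t"
    proof -
      \<comment> \<open>The index of the cell that contains \<open>s\<close>, and its right end.\<close>
      define j where "j n = nat \<lfloor>s / (t / real n)\<rfloor>" for n
      define r where "r n = real (Suc (j n)) * (t / real n)" for n
      have bounds: "j n < n" "real (j n) * (t / real n) \<le> s" "s < r n" "r n \<le> s + t / real n" if "0 < n" for n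
      proof -
        have h: "0 < t / real n" using s that by simp
        have "0 \<le> s / (t / real n)" using s h by simp
        then have j: "real (j n) \<le> s / (t / real n)" "s / (t / real n) < real (Suc (j n))"
          unfolding j_def by linarith+
        have "s / (t / real n) < real n" using s that by (simp add: field_simps)
        with j show "j n < n" by linarith
        show jh: "real (j n) * (t / real n) \<le> s" using j(1) unfolding pos_le_divide_eq[OF h] .
        show "s < r n" using j(2) unfolding pos_divide_less_eq[OF h] r_def .
        show "r n \<le> s + t / real n"
          using jh unfolding r_def of_nat_Suc distrib_right mult_1_left by linarith
      qed
      have "filterlim r (at_right s) sequentially"
        unfolding filterlim_at
      proof
        show "\<forall>\<^sub>F n in sequentially. r n \<in> {s<..} \<and> r n \<noteq> s"
          using eventually_gt_at_top[of 0]
          proof eventually_elim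
            case (elim n)
            then show ?case using bounds(3)[OF elim] by simp
          qed
        show "r \<longlonglongrightarrow> s"
        proof (rule real_tendsto_sandwich)
          show "\<forall>\<^sub>F n in sequentially. s \<le> r n"
            using eventually_gt_at_top[of 0]
          proof eventually_elim
            case (elim n)
            then show ?case using bounds(3)[OF elim] by simp
          qed
          show "\<forall>\<^sub>F n in sequentially. r n \<le> s + t / real n"
            using eventually_gt_at_top[of 0]
          proof eventually_elim
            case (elim n)
            then show ?case using bounds(4)[OF elim] by simp
          qed
          show "(\<lambda>n. s + t / real n) \<longlonglongrightarrow> s" by real_asymp
        qed simp
      qed
      then have "(\<lambda>n. ennreal (v (r n))) \<longlonglongrightarrow> ennreal (v s)"
        using cont[OF s(1)] unfolding continuous_within
        by (intro tendsto_ennrealI) (rule filterlim_compose)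
      then have "ennreal (v s) = liminf (\<lambda>n. ennreal (v (r n)))"
        using lim_imp_Liminf[OF sequentially_bot] by metis
      also have "\<dots> \<le> liminf (\<lambda>n. S n s)"
      proof (rule Liminf_mono)
        show "\<forall>\<^sub>F n in sequentially. ennreal (v (r n)) \<le> S n s"
          using eventually_gt_at_top[of 0]
        proof eventually_elim
          case (elim n)
          have "ennreal (v (r n)) = ennreal (v (real (Suc (j n)) * (t / real n)))
              * indicator {real (j n) * (t / real n) ..< real (Suc (j n)) * (t / real n)} s"
            using bounds[OF elim] by (auto simp: r_def indicator_def)
          also have "\<dots> \<le> S n s"
            unfolding S_def using bounds[OF elim]
            by (intro member_le_sum[where f = "\<lambda>i. ennreal (v (real (Suc i) * (t / real n)))
              * indicator {real i * (t / real n) ..< real (Suc i) * (t / real n)} s"]) auto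
          finally show ?case .
        qed
      qed
      finally show ?thesis .
    qed
    then show "ennreal (v s) * indicator {0..<t} s \<le> liminf (\<lambda>n. S n s)"
      by (auto simp: indicator_def)
  qed
  also have "\<dots> \<le> liminf (\<lambda>n. \<integral>\<^sup>+s. S n s \<partial>lborel)"
    unfolding S_def by (rule nn_integral_liminf) measurable
  also have "(\<lambda>n. \<integral>\<^sup>+s. S n s \<partial>lborel) = (\<lambda>n. ennreal (\<Sum>i<n. t / real n * v (real (Suc i) * (t / real n))))"
  proof
    fix n
    have "(\<integral>\<^sup>+s. S n s \<partial>lborel) = (\<Sum>i<n. ennreal (v (real (Suc i) * (t / real n))) * ennreal (t / real n))"
      unfolding S_def using t
      by (subst nn_integral_sum) (auto simp: nn_integral_cmult_indicator algebra_simps add_divide_distrib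
          intro!: sum.cong)
    also have "\<dots> = ennreal (\<Sum>i<n. t / real n * v (real (Suc i) * (t / real n)))"
      using t v by (subst sum_ennreal[symmetric]) (auto simp: ennreal_mult[symmetric] mult.commute)
    finally show "(\<integral>\<^sup>+s. S n s \<partial>lborel) = ennreal (\<Sum>i<n. t / real n * v (real (Suc i) * (t / real n)))" .
  qed
  finally show ?thesis .
qed

lemma limsup_exp_minus_le:
  fixes R :: "nat \<Rightarrow> real"
  assumes R: "\<And>n. 0 \<le> R n" and L: "ennreal L \<le> liminf (\<lambda>n. ennreal (R n))"
  shows "limsup (\<lambda>n. ennreal (exp (- R n))) \<le> ennreal (exp (- L))"
proof (cases "0 < L")
  case False
  show ?thesis
  proof (rule Limsup_bounded, intro always_eventually allI ennreal_leI)
    show "exp (- R n) \<le> exp (- L)" for n using False R[of n] by simp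
  qed
next
  case True
  have bound: "limsup (\<lambda>n. ennreal (exp (- R n))) \<le> ennreal (exp (- c))" if "0 < c" "c < L" for c
  proof -
    have "ennreal c < ennreal L" using that by (simp add: ennreal_less_iff)
    then have "ennreal c < liminf (\<lambda>n. ennreal (R n))" using L by simp
    from less_LiminfD[OF this] show ?thesis
    proof (intro Limsup_bounded, eventually_elim)
      case (elim n)
      then have "c < R n" using that by (simp add: ennreal_less_iff)
      then show ?case by (intro ennreal_leI) simp
    qed
  qed
  show ?thesis
  proof (rule tendsto_lowerbound)
    show "((\<lambda>c. ennreal (exp (- c))) \<longlongrightarrow> ennreal (exp (- L))) (at_left L)"
      by (intro tendsto_intros)
    show "\<forall>\<^sub>F c in at_left L. limsup (\<lambda>n. ennreal (exp (- R n))) \<le> ennreal (exp (- c))"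
      using eventually_at_left_real[OF True] by eventually_elim (auto intro: bound)
  qed simp
qed

context markov_chain
begin

text \<open>
  One factor of the Trotter product: move for a time \<open>h\<close>, then weight by the potential at the
  arrival state.
\<close>

definition tilted :: "(nat \<Rightarrow> real) \<Rightarrow> real \<Rightarrow> (nat \<Rightarrow> real) \<Rightarrow> nat \<Rightarrow> real" where
  "tilted V h v y = measure_pmf.expectation (law h y) (\<lambda>z. exp (- (h * V z)) * v z)"

lemma tilted_weight_bounds:
  assumes "0 \<le> h" "\<And>z. 0 \<le> V z" "\<And>z. v z \<in> {0..1}"
  shows "exp (- (h * V z)) * v z \<in> {0..1 :: real}"
  using assms mult_le_one[of "exp (- (h * V z))" "v z"] by auto

lemma integrable_tilted_weight:
  assumes "0 \<le> h" "\<And>z. 0 \<le> V z" "\<And>z. v z \<in> {0..1}"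
  shows "integrable (law h y) (\<lambda>z. exp (- (h * V z)) * v z)"
  using tilted_weight_bounds[of h V v] assms
  by (intro measure_pmf.integrable_const_bound[where B = 1]) auto

lemma tilted_bounds:
  assumes "0 \<le> h" "\<And>z. 0 \<le> V z" "\<And>z. v z \<in> {0..1}"
  shows "tilted V h v y \<in> {0..1}"
  using tilted_weight_bounds[of h V v] assms integrable_tilted_weight[OF assms]
  unfolding tilted_def by (auto intro!: measure_pmf.integral_le_const)

lemma tilted_power_bounds:
  assumes "0 \<le> h" "\<And>z. 0 \<le> V z" "\<And>z. v z \<in> {0..1}"
  shows "(tilted V h ^^ n) v y \<in> {0..1}"
proof (induction n arbitrary: y)
  case (Suc n)
  then show ?case using tilted_bounds[OF assms(1,2)] by simp
qed (use assms in simp)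

lemma ennreal_tilted:
  assumes "0 \<le> h" "\<And>z. 0 \<le> V z" "\<And>z. v z \<in> {0..1}"
  shows "ennreal (tilted V h v y) = (\<integral>\<^sup>+z. ennreal (exp (- (h * V z))) * ennreal (v z) \<partial>law h y)"
  using tilted_weight_bounds[of h V v] assms integrable_tilted_weight[OF assms]
  unfolding tilted_def by (subst nn_integral_eq_integral[symmetric]) (auto simp: ennreal_mult)

text \<open>
  Conditioning on the past at the last but one grid time absorbs the last factor into the
  integrand; the remaining weight is a function of the past.
\<close>

lemma tilted_power_eq_path_integral:
  assumes h: "0 \<le> h" and V: "\<And>z. 0 \<le> V z" and v: "\<And>z. v z \<in> {0..1}"
  shows "(\<integral>\<^sup>+\<omega>. (\<Prod>i<n. ennreal (exp (- (h * V (X (real (Suc i) * h) \<omega>))))) * ennreal (v (X (real n * h) \<omega>)) \<partial>P x)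
    = ennreal ((tilted V h ^^ n) v x)"
  using v
proof (induction n arbitrary: v)
  case 0
  interpret P: prob_space "P x" by (rule prob_space)
  have "(\<integral>\<^sup>+\<omega>. ennreal (v (X 0 \<omega>)) \<partial>P x) = (\<integral>\<^sup>+\<omega>. ennreal (v x) \<partial>P x)"
    using start[of x] by (intro nn_integral_cong_AE) auto
  then show ?case by (simp add: P.emeasure_space_1)
next
  case (Suc n)
  let ?D = "\<lambda>z. ennreal (exp (- (h * V z)))"
  let ?\<Phi> = "\<lambda>\<omega>. \<Prod>i<n. ?D (X (real (Suc i) * h) \<omega>)"
  have meas: "?\<Phi> \<in> borel_measurable (past x (real n * h))"
  proof (rule borel_measurable_prod_ennreal)
    fix i assume "i \<in> {..<n}"
    then have [measurable]: "X (real (Suc i) * h) \<in> measurable (past x (real n * h)) (count_space UNIV)"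
      using h by (intro measurable_X_past mult_right_mono) auto
    show "(\<lambda>\<omega>. ?D (X (real (Suc i) * h) \<omega>)) \<in> borel_measurable (past x (real n * h))"
      by measurable
  qed
  have "(\<integral>\<^sup>+\<omega>. (\<Prod>i<Suc n. ?D (X (real (Suc i) * h) \<omega>)) * ennreal (v (X (real (Suc n) * h) \<omega>)) \<partial>P x)
    = (\<integral>\<^sup>+\<omega>. ?\<Phi> \<omega> * (\<lambda>z. ?D z * ennreal (v z)) (X (real n * h + h) \<omega>) \<partial>P x)"
    by (simp add: algebra_simps)
  also have "\<dots> = (\<integral>\<^sup>+\<omega>. ?\<Phi> \<omega> * ennreal (tilted V h v (X (real n * h) \<omega>)) \<partial>P x)"
    using h by (subst weighted_markov[OF _ _ meas]) (simp_all add: ennreal_tilted[OF h V Suc.prems])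
  also have "\<dots> = ennreal ((tilted V h ^^ n) (tilted V h v) x)"
    using tilted_bounds[OF h V Suc.prems] by (rule Suc.IH)
  finally show ?case by (simp only: funpow_Suc_right o_apply)
qed

text \<open>
  By \<open>integral_le_liminf_right_endpoint_sums\<close> and \<open>limsup_exp_minus_le\<close> the exponential weight of a
  path dominates the upper limit of its discretised weights, and the reverse Fatou lemma (the weights are at most \<open>1\<close>) passes to expectations.
  The sum over the end point \<open>z\<close> is interchanged with the expectation of this upper limit, which is
  measurable as a limit of measurable weights.
\<close>

lemma feynman_kac_ge_product_limit:
  assumes t: "0 \<le> t" and V: "\<And>z. 0 \<le> V z"
  shows "(\<Sum>z. g z * limsup (\<lambda>n. ennreal ((tilted V (t / real n) ^^ n) (indicator {z}) x)))
    \<le> feynman_kac P X V t g x"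
proof -
  interpret P: prob_space "P x" by (rule prob_space)
  define W where "W n \<omega> = (\<Prod>i<n. ennreal (exp (- (t / real n * V (X (real (Suc i) * (t / real n)) \<omega>)))))" for n \<omega>
  define R where "R n \<omega> = (\<Sum>i<n. t / real n * V (X (real (Suc i) * (t / real n)) \<omega>))" for n \<omega>
  have W_eq: "W n \<omega> = ennreal (exp (- R n \<omega>))" for n \<omega>
    by (simp add: W_def R_def prod_ennreal exp_sum[symmetric] sum_negf)
  have R0: "0 \<le> R n \<omega>" for n \<omega>
    unfolding R_def using t V by (intro sum_nonneg) auto
  have [measurable]: "X t \<in> measurable (P x) (count_space UNIV)"
    "X (real i * (t / real n)) \<in> measurable (P x) (count_space UNIV)" for i n
    using t by (auto intro!: measurable_X)
  have W [measurable]: "W n \<in> borel_measurable (P x)" for n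
    unfolding W_def[abs_def] by measurable
  have ind [measurable]: "(\<lambda>\<omega>. indicator {z} (X t \<omega>) :: ennreal) \<in> borel_measurable (P x)" for z
    using measurable_compose[of "X t" "P x" "count_space UNIV" "indicator {z}" borel] t
    by (simp add: measurable_X)
  have path: "limsup (\<lambda>n. W n \<omega>) \<le> ennreal (exp (- (LINT s:{0..t}|lborel. V (X s \<omega>))))"
    if \<omega>: "\<omega> \<in> space (P x)" for \<omega>
    unfolding W_eq
  proof (rule limsup_exp_minus_le[OF R0])
    have "continuous (at_right s) (\<lambda>s. V (X s \<omega>))" if "0 \<le> s" for s
      using right_continuous[OF \<omega> that] unfolding continuous_within tendsto_discrete
      by (intro tendsto_eventually) (auto elim: eventually_mono)
    then show "ennreal (LINT s:{0..t}|lborel. V (X s \<omega>)) \<le> liminf (\<lambda>n. ennreal (R n \<omega>))"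
      unfolding R_def using t V by (intro integral_le_liminf_right_endpoint_sums) auto
  qed
  have point: "limsup (\<lambda>n. ennreal ((tilted V (t / real n) ^^ n) (indicator {z}) x))
      \<le> (\<integral>\<^sup>+\<omega>. indicator {z} (X t \<omega>) * limsup (\<lambda>n. W n \<omega>) \<partial>P x)" for z
  proof -
    have "limsup (\<lambda>n. ennreal ((tilted V (t / real n) ^^ n) (indicator {z}) x))
        = limsup (\<lambda>n. \<integral>\<^sup>+\<omega>. indicator {z} (X t \<omega>) * W n \<omega> \<partial>P x)"
    proof (rule Limsup_eq)
      show "\<forall>\<^sub>F n in sequentially. ennreal ((tilted V (t / real n) ^^ n) (indicator {z}) x)
        = (\<integral>\<^sup>+\<omega>. indicator {z} (X t \<omega>) * W n \<omega> \<partial>P x)"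
        using eventually_gt_at_top[of 0]
      proof eventually_elim
        case (elim n)
        have "ennreal ((tilted V (t / real n) ^^ n) (indicator {z}) x)
          = (\<integral>\<^sup>+\<omega>. W n \<omega> * ennreal (indicator {z} (X (real n * (t / real n)) \<omega>)) \<partial>P x)"
          unfolding W_def using t V by (subst tilted_power_eq_path_integral) (auto simp: indicator_def)
        also have "\<dots> = (\<integral>\<^sup>+\<omega>. indicator {z} (X t \<omega>) * W n \<omega> \<partial>P x)"
          using elim by (intro nn_integral_cong) (auto simp: indicator_def)
        finally show ?case .
      qed
    qed
    also have "\<dots> \<le> (\<integral>\<^sup>+\<omega>. limsup (\<lambda>n. indicator {z} (X t \<omega>) * W n \<omega>) \<partial>P x)"
    proof (rule nn_integral_limsup[where w = "\<lambda>_. 1"])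
      show "AE \<omega> in P x. indicator {z} (X t \<omega>) * W n \<omega> \<le> 1" for n
        using R0 by (auto simp: W_eq indicator_def)
      show "(\<lambda>\<omega>. indicator {z} (X t \<omega>) * W n \<omega>) \<in> borel_measurable (P x)" for n
        by (intro borel_measurable_times_ennreal ind W)
    qed (simp_all add: P.emeasure_space_1)
    also have "\<dots> = (\<integral>\<^sup>+\<omega>. indicator {z} (X t \<omega>) * limsup (\<lambda>n. W n \<omega>) \<partial>P x)"
      by (intro nn_integral_cong) (auto simp: indicator_def Limsup_const)
    finally show ?thesis .
  qed
  have "(\<Sum>z. g z * limsup (\<lambda>n. ennreal ((tilted V (t / real n) ^^ n) (indicator {z}) x)))
    \<le> (\<Sum>z. g z * (\<integral>\<^sup>+\<omega>. indicator {z} (X t \<omega>) * limsup (\<lambda>n. W n \<omega>) \<partial>P x))"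
    by (intro suminf_le mult_left_mono point) auto
  also have "\<dots> = (\<integral>\<^sup>+\<omega>. (\<Sum>z. g z * (indicator {z} (X t \<omega>) * limsup (\<lambda>n. W n \<omega>))) \<partial>P x)"
    by (subst nn_integral_suminf) (auto simp: nn_integral_cmult)
  also have "\<dots> = (\<integral>\<^sup>+\<omega>. g (X t \<omega>) * limsup (\<lambda>n. W n \<omega>) \<partial>P x)"
  proof (rule nn_integral_cong)
    fix \<omega>
    have "(\<Sum>z. g z * (indicator {z} (X t \<omega>) * limsup (\<lambda>n. W n \<omega>)))
        = (\<Sum>z. g z * limsup (\<lambda>n. W n \<omega>) * indicator {z} (X t \<omega>))"
      by (simp add: ac_simps)
    also have "\<dots> = g (X t \<omega>) * limsup (\<lambda>n. W n \<omega>)"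
      by (rule suminf_cmult_indicator) (auto simp: disjoint_family_on_def)
    finally show "(\<Sum>z. g z * (indicator {z} (X t \<omega>) * limsup (\<lambda>n. W n \<omega>))) = g (X t \<omega>) * limsup (\<lambda>n. W n \<omega>)" .
  qed
  also have "\<dots> \<le> feynman_kac P X V t g x"
    unfolding feynman_kac_def by (intro nn_integral_mono mult_left_mono path) auto
  finally show ?thesis .
qed

end

section \<open>Comparison of two starting points\<close>

context birth_death_process
begin

text \<open>
  The increments \<open>P\<^sub>sf(x + 1) - P\<^sub>sf(x)\<close> satisfy a closed equation: that of the \<open>1\<close>-modification with
  killing rate \<open>potential1 lam \<nu>\<close>. They therefore stay nonnegative.
\<close>

lemma expectation_mono_start:
  fixes f :: "nat \<Rightarrow> real"
  assumes nonneg: "\<And>x. 0 \<le> lam x" "\<And>x. 0 \<le> \<nu> x" "\<nu> 0 = 0"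
    and mono: "decseq lam" "incseq \<nu>"
    and f: "incseq f" "\<And>y. \<bar>f y\<bar> \<le> M" and t: "0 \<le> t"
  shows "measure_pmf.expectation (law t x) f \<le> measure_pmf.expectation (law t (x + 1)) f"
proof -
  define U where "U s x = measure_pmf.expectation (law s x) f" for s x
  have step: "\<bar>U (s + h) x - U s x - h * generator lam \<nu> (U s) x\<bar> \<le> h * (M * short_time_error x h)"
    if "0 \<le> s" "0 \<le> h" for s h x
    unfolding U_def using that by (rule semigroup_step) (rule f(2))
  have "U t x - U t (x + 1) \<le> 0"
  proof (rule maximum_principle[where W = "\<lambda>s x. U s x - U s (x + 1)" and M = "2 * M" and c = "lam 0"
        and b = "\<lambda>x. lam (x + 1)" and d = \<nu> and k = "\<lambda>x. lam x + \<nu> (x + 1)"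
        and \<eta> = "\<lambda>x h. M * short_time_error x h + M * short_time_error (x + 1) h"])
    fix s h x assume sh: "(0::real) \<le> s" "(0::real) \<le> h"
    have "generator lam \<nu> (U s) x - generator lam \<nu> (U s) (x + 1)
      = lam (x + 1) * (U s (x + 1) - U s (x + 1 + 1)) + \<nu> x * (U s (x - 1) - U s (x - 1 + 1))
         - (lam x + \<nu> (x + 1)) * (U s x - U s (x + 1))"
      using nonneg(3) by (cases x) (simp_all add: generator_def fdiff_def bdiff_def algebra_simps)
    then have "h * generator lam \<nu> (U s) x - h * generator lam \<nu> (U s) (x + 1)
      = h * (lam (x + 1) * (U s (x + 1) - U s (x + 1 + 1)) + \<nu> x * (U s (x - 1) - U s (x - 1 + 1))
         - (lam x + \<nu> (x + 1)) * (U s x - U s (x + 1)))"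
      by (simp only: right_diff_distrib[symmetric])
    then show "U (s + h) x - U (s + h) (x + 1) \<le> U s x - U s (x + 1)
       + h * (lam (x + 1) * (U s (x + 1) - U s (x + 1 + 1)) + \<nu> x * (U s (x - 1) - U s (x - 1 + 1))
         - (lam x + \<nu> (x + 1)) * (U s x - U s (x + 1)))
       + h * (M * short_time_error x h + M * short_time_error (x + 1) h)"
      using step[OF sh, of x] step[OF sh, of "x + 1"]
      unfolding distrib_left[of h "M * _"] by linarith
  next
    have "\<bar>U s x\<bar> \<le> M" for s x
      unfolding U_def by (rule abs_expectation_pmf_le) (rule f(2))
    then show "U s x - U s (x + 1) \<le> 2 * M" for s x
      by (smt (verit))
    show "((\<lambda>h. M * short_time_error x h + M * short_time_error (x + 1) h) \<longlongrightarrow> 0) (at_right 0)" for x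
      using tendsto_add[OF tendsto_mult_left[OF short_time_error_tendsto_0] tendsto_mult_left[OF short_time_error_tendsto_0]]
      by simp
    show "lam (x + 1) + \<nu> x \<le> lam x + \<nu> (x + 1)" for x
      using decseq_SucD[OF mono(1), of x] incseq_SucD[OF mono(2), of x] by simp
    show "lam (x + 1) \<le> lam 0" for x using decseqD[OF mono(1), of 0] by simp
    show "U 0 x - U 0 (x + 1) \<le> 0" for x
      using incseqD[OF f(1), of x "Suc x"] by (simp add: U_def law_0)
  qed (use nonneg t in auto)
  then show ?thesis by (simp add: U_def)
qed

text \<open>
  In coupling terms: the copy started at \<open>x + 1\<close> never gets more than one step above the other one.
  Since the increments of both functions in the starting point are nonnegative
  (\<open>expectation_mono_start\<close>), the monotone rates may be replaced by those at \<open>x + 1\<close> at the cost of an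
  inequality in the right direction. From \<open>x = 0\<close> only the upper copy can jump down, which
  is why \<open>d 0 = 0\<close> in the proof.
\<close>

lemma expectation_shift_start:
  fixes f f' :: "nat \<Rightarrow> real"
  assumes nonneg: "\<And>x. 0 \<le> lam x" "\<And>x. 0 \<le> \<nu> x" "\<nu> 0 = 0"
    and mono: "decseq lam" "incseq \<nu>"
    and f: "incseq f" "\<And>y. \<bar>f y\<bar> \<le> M" and f': "incseq f'" "\<And>y. \<bar>f' y\<bar> \<le> M"
    and le: "\<And>y. f' (y + 1) \<le> f y" and t: "0 \<le> t"
  shows "measure_pmf.expectation (law t (x + 1)) f' \<le> measure_pmf.expectation (law t x) f"
proof -
  define U where "U s x = measure_pmf.expectation (law s x) f" for s x
  have step: "\<bar>U (s + h) x - U s x - h * generator lam \<nu> (U s) x\<bar> \<le> h * (M * short_time_error x h)"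
    if "0 \<le> s" "0 \<le> h" for s h x
    unfolding U_def using that by (rule semigroup_step) (rule f(2))
  define U' where "U' s x = measure_pmf.expectation (law s x) f'" for s x
  have step': "\<bar>U' (s + h) x - U' s x - h * generator lam \<nu> (U' s) x\<bar> \<le> h * (M * short_time_error x h)"
    if "0 \<le> s" "0 \<le> h" for s h x
    unfolding U'_def using that by (rule semigroup_step) (rule f'(2))
  have incU: "U s x \<le> U s (x + 1)" and incU': "U' s x \<le> U' s (x + 1)" if "0 \<le> s" for s x
    unfolding U_def U'_def
    using expectation_mono_start[where f = f and M = M, OF nonneg mono f that]
      expectation_mono_start[where f = f' and M = M, OF nonneg mono f' that] by simp_all
  define d where "d x = (if x = 0 then 0 else \<nu> (x + 1))" for x
  have "U' t (x + 1) - U t x \<le> 0"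
  proof (rule maximum_principle[where W = "\<lambda>s x. U' s (x + 1) - U s x" and M = "2 * M" and c = "lam 0"
        and b = "\<lambda>x. lam (x + 1)" and d = d and k = "\<lambda>x. lam (x + 1) + d x"
        and \<eta> = "\<lambda>x h. M * short_time_error (x + 1) h + M * short_time_error x h"])
    fix s h x assume sh: "(0::real) \<le> s" "(0::real) \<le> h"
    have "generator lam \<nu> (U' s) (x + 1) - generator lam \<nu> (U s) x
      \<le> lam (x + 1) * (U' s (x + 1 + 1) - U s (x + 1)) + d x * (U' s (x - 1 + 1) - U s (x - 1))
         - (lam (x + 1) + d x) * (U' s (x + 1) - U s x)"
    proof -
      \<comment> \<open>The surplus birth rate of the lower copy only brings the copies closer.\<close>
      have "0 \<le> (lam x - lam (x + 1)) * (U s (x + 1) - U s x)"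
        using incU[OF sh(1)] decseq_SucD[OF mono(1), of x] by (intro mult_nonneg_nonneg) auto
      moreover have "\<nu> (x + 1) * (U' s x - U' s (x + 1)) - \<nu> x * (U s (x - 1) - U s x)
         \<le> d x * (U' s (x - 1 + 1) - U s (x - 1)) - d x * (U' s (x + 1) - U s x)"
      proof (cases x)
        case 0
        have "\<nu> 1 * (U' s 0 - U' s 1) \<le> 0"
          using incU'[OF sh(1), of 0] nonneg(2)[of 1] by (intro mult_nonneg_nonpos) auto
        then show ?thesis by (simp add: 0 d_def)
      next
        case (Suc y)
        have "0 \<le> (\<nu> (x + 1) - \<nu> x) * (U s x - U s (x - 1))"
          using incU[OF sh(1), of y] incseq_SucD[OF mono(2), of x]
          by (intro mult_nonneg_nonneg) (auto simp: Suc)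
        then show ?thesis by (simp add: Suc d_def algebra_simps)
      qed
      ultimately show ?thesis
        by (simp add: generator_def fdiff_def bdiff_def algebra_simps)
    qed
    from mult_left_mono[OF this sh(2)]
    have "h * generator lam \<nu> (U' s) (x + 1) - h * generator lam \<nu> (U s) x
      \<le> h * (lam (x + 1) * (U' s (x + 1 + 1) - U s (x + 1)) + d x * (U' s (x - 1 + 1) - U s (x - 1))
         - (lam (x + 1) + d x) * (U' s (x + 1) - U s x))"
      by (simp only: right_diff_distrib[symmetric])
    then show "U' (s + h) (x + 1) - U (s + h) x \<le> U' s (x + 1) - U s x
       + h * (lam (x + 1) * (U' s (x + 1 + 1) - U s (x + 1)) + d x * (U' s (x - 1 + 1) - U s (x - 1))
         - (lam (x + 1) + d x) * (U' s (x + 1) - U s x))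
       + h * (M * short_time_error (x + 1) h + M * short_time_error x h)"
      using step[OF sh, of x] step'[OF sh, of "x + 1"]
      unfolding distrib_left[of h "M * _"] by linarith
  next
    have "\<bar>U s x\<bar> \<le> M" for s x
      unfolding U_def by (rule abs_expectation_pmf_le) (rule f(2))
    moreover have "\<bar>U' s x\<bar> \<le> M" for s x
      unfolding U'_def by (rule abs_expectation_pmf_le) (rule f'(2))
    ultimately show "U' s (x + 1) - U s x \<le> 2 * M" for s x
      by (smt (verit))
    show "((\<lambda>h. M * short_time_error (x + 1) h + M * short_time_error x h) \<longlongrightarrow> 0) (at_right 0)" for x
      using tendsto_add[OF tendsto_mult_left[OF short_time_error_tendsto_0] tendsto_mult_left[OF short_time_error_tendsto_0]]
      by simp
    show "lam (x + 1) \<le> lam 0" for x using decseqD[OF mono(1), of 0] by simp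
    show "U' 0 (x + 1) - U 0 x \<le> 0" for x
      using le[of x] by (simp add: U_def U'_def law_0)
  qed (use nonneg t in \<open>auto simp: d_def\<close>)
  then show ?thesis by (simp add: U_def U'_def)
qed

text \<open>
  The function \<open>x + lam 0 * s\<close> is a supersolution. It is compared with truncations of the
  identity because the expansion is available for bounded functions only.
\<close>

lemma expectation_truncation_le:
  assumes nonneg: "\<And>x. 0 \<le> lam x" "\<And>x. 0 \<le> \<nu> x" and mono: "decseq lam" and t: "0 \<le> t"
  shows "measure_pmf.expectation (law t x) (\<lambda>y. min (real y) (real K)) \<le> real x + lam 0 * t"
proof -
  let ?f = "\<lambda>y. min (real y) (real K)"
  have f: "\<bar>?f y\<bar> \<le> real K" for y by simp
  define U where "U s x = measure_pmf.expectation (law s x) ?f" for s x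
  have step: "\<bar>U (s + h) x - U s x - h * generator lam \<nu> (U s) x\<bar> \<le> h * (real K * short_time_error x h)"
    if "0 \<le> s" "0 \<le> h" for s h x
    unfolding U_def using that by (rule semigroup_step) (rule f)
  have "U t x - (real x + lam 0 * t) \<le> 0"
  proof (rule maximum_principle[where W = "\<lambda>s x. U s x - (real x + lam 0 * s)" and M = "real K" and c = "lam 0"
        and b = lam and d = \<nu> and k = "\<lambda>x. lam x + \<nu> x"
        and \<eta> = "\<lambda>x h. real K * short_time_error x h"])
    fix s h x assume sh: "(0::real) \<le> s" "(0::real) \<le> h"
    have "generator lam \<nu> (U s) x - lam 0
      \<le> lam x * (U s (x + 1) - (real (x + 1) + lam 0 * s)) + \<nu> x * (U s (x - 1) - (real (x - 1) + lam 0 * s))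
         - (lam x + \<nu> x) * (U s x - (real x + lam 0 * s))"
      using decseqD[OF mono, of 0 x] nonneg(2)[of x]
      by (cases x) (simp_all add: generator_def fdiff_def bdiff_def algebra_simps)
    from mult_left_mono[OF this sh(2)]
    show "U (s + h) x - (real x + lam 0 * (s + h)) \<le> U s x - (real x + lam 0 * s)
       + h * (lam x * (U s (x + 1) - (real (x + 1) + lam 0 * s)) + \<nu> x * (U s (x - 1) - (real (x - 1) + lam 0 * s))
         - (lam x + \<nu> x) * (U s x - (real x + lam 0 * s)))
       + h * (real K * short_time_error x h)"
      using step[OF sh, of x]
      unfolding right_diff_distrib[of h _ "lam 0"] distrib_left[of "lam 0"] mult.commute[of "lam 0" h]
      by linarith
  next
    have "\<bar>U s x\<bar> \<le> real K" for s x
      unfolding U_def by (rule abs_expectation_pmf_le) (rule f)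
    moreover have "0 \<le> real x + lam 0 * s" if "0 \<le> s" for s x
      using that nonneg by simp
    ultimately show "U s x - (real x + lam 0 * s) \<le> real K" if "0 \<le> s" for s x
      using that by (smt (verit))
    show "((\<lambda>h. real K * short_time_error x h) \<longlongrightarrow> 0) (at_right 0)" for x
      using tendsto_mult_left[OF short_time_error_tendsto_0] by simp
    show "lam x \<le> lam 0" for x using decseqD[OF mono, of 0] by simp
    show "U 0 x - (real x + lam 0 * 0) \<le> 0" for x
      by (simp add: U_def law_0)
  qed (use nonneg t in auto)
  then show ?thesis by (simp add: U_def)
qed

lemma integrable_law_Lipschitz:
  fixes f :: "nat \<Rightarrow> real"
  assumes nonneg: "\<And>x. 0 \<le> lam x" "\<And>x. 0 \<le> \<nu> x" and mono: "decseq lam" and t: "0 \<le> t"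
    and f: "\<And>y. \<bar>fdiff f y\<bar> \<le> C"
  shows "integrable (law t x) f"
proof -
  have "(\<integral>\<^sup>+y. ennreal (real y) \<partial>law t x) \<le> (\<integral>\<^sup>+y. liminf (\<lambda>K. ennreal (min (real y) (real K))) \<partial>law t x)"
  proof (rule nn_integral_mono)
    fix y
    have "\<forall>\<^sub>F K in sequentially. ennreal (real y) = ennreal (min (real y) (real K))"
      using eventually_ge_at_top[of y] by eventually_elim simp
    then have "liminf (\<lambda>K. ennreal (min (real y) (real K))) = liminf (\<lambda>K. ennreal (real y))"
      by (intro Liminf_eq) (auto elim: eventually_mono)
    then show "ennreal (real y) \<le> liminf (\<lambda>K. ennreal (min (real y) (real K)))"
      by (simp add: Liminf_const)
  qed
  also have "\<dots> \<le> liminf (\<lambda>K. \<integral>\<^sup>+y. ennreal (min (real y) (real K)) \<partial>law t x)"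
    by (rule nn_integral_liminf) simp
  also have "\<dots> \<le> liminf (\<lambda>K. ennreal (real x + lam 0 * t))"
  proof (rule Liminf_mono, rule always_eventually, rule allI)
    fix K
    have "integrable (law t x) (\<lambda>y. min (real y) (real K))"
      by (intro measure_pmf.integrable_const_bound[where B = "real K"]) auto
    then have "(\<integral>\<^sup>+y. ennreal (min (real y) (real K)) \<partial>law t x)
        = ennreal (measure_pmf.expectation (law t x) (\<lambda>y. min (real y) (real K)))"
      by (intro nn_integral_eq_integral) auto
    also have "\<dots> \<le> ennreal (real x + lam 0 * t)"
      by (intro ennreal_leI expectation_truncation_le nonneg mono t)
    finally show "(\<integral>\<^sup>+y. ennreal (min (real y) (real K)) \<partial>law t x) \<le> ennreal (real x + lam 0 * t)" .
  qed
  also have "\<dots> < \<infinity>" by (simp add: Liminf_const)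
  finally have int: "integrable (law t x) real"
    by (intro integrableI_bounded) auto
  have growth: "\<bar>f y\<bar> \<le> \<bar>f 0\<bar> + C * real y" for y
  proof (induction y)
    case (Suc y)
    then show ?case using f[of y] by (simp add: fdiff_def algebra_simps)
  qed simp
  show ?thesis
  proof (rule Bochner_Integration.integrable_bound)
    show "integrable (law t x) (\<lambda>y. \<bar>f 0\<bar> + C * real y)" using int by simp
    show "AE y in law t x. norm (f y) \<le> norm (\<bar>f 0\<bar> + C * real y)"
      using growth by (intro AE_I2) (smt (verit) real_norm_def)
  qed simp
qed

text \<open>
  Up to errors of smaller order than \<open>h\<close>, one factor of the product dominates an Euler step for the
  generator with killing rate \<open>V\<close>. Since \<open>v\<close> is at
  most \<open>1\<close>, replacing \<open>exp (- h V)\<close> by \<open>1 - h V\<close> at the two neighbours costs a term of second order.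
\<close>

lemma tilted_step:
  assumes nonneg: "0 \<le> lam x" "0 \<le> \<nu> x" and h: "0 \<le> h"
    and V: "\<And>z. 0 \<le> V z" and v: "\<And>z. v z \<in> {0..1}"
  shows "v x + h * (generator lam \<nu> v x - V x * v x)
      - h * (short_time_error x h + h * (lam x * V (x + 1) + \<nu> x * V (x - 1))) \<le> tilted V h v x"
proof -
  define g where "g y = exp (- (h * V y)) * v y" for y
  have g: "\<bar>g y\<bar> \<le> 1" for y
    using tilted_weight_bounds[of h V v y] h V v by (auto simp: g_def)
  have upper: "g y \<le> v y" for y
    using v[of y] h V[of y] by (auto simp: g_def intro!: mult_left_le_one_le)
  have lower: "v y - h * V y * v y \<le> g y" for y
  proof -
    have "(1 + - (h * V y)) * v y \<le> exp (- (h * V y)) * v y"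
      using v[of y] by (intro mult_right_mono exp_ge_add_one_self) auto
    then show ?thesis by (simp add: g_def algebra_simps)
  qed
  have lower': "v y - h * V y \<le> g y" for y
  proof -
    have "h * V y * v y \<le> h * V y * 1" using v[of y] h V[of y] by (intro mult_left_mono) auto
    with lower[of y] show ?thesis by simp
  qed
  have "lam x * (v (x + 1) - v x - h * V (x + 1)) + \<nu> x * (v (x - 1) - v x - h * V (x - 1))
      \<le> generator lam \<nu> g x"
    unfolding generator_def fdiff_def bdiff_def
    using lower'[of "x + 1"] lower'[of "x - 1"] upper[of x] nonneg
    by (intro add_mono mult_left_mono) linarith+
  then have "generator lam \<nu> v x - h * (lam x * V (x + 1) + \<nu> x * V (x - 1)) \<le> generator lam \<nu> g x"
    by (simp add: generator_def fdiff_def bdiff_def algebra_simps)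
  from mult_left_mono[OF this h] short_time_expansion[where u = g and M = 1, OF h g, of x] lower[of x]
  show ?thesis
    unfolding tilted_def g_def[symmetric] by (simp add: algebra_simps)
qed

text \<open>
  Both sides start from the indicator of \<open>z\<close> and follow the same scheme, the left side by the
  equation for increments and the right side by \<open>tilted_step\<close>; the maximum principle applies to their difference.
\<close>

lemma tail_increment_le_product_limit:
  assumes nonneg: "\<And>x. 0 \<le> lam x" "\<And>x. 0 \<le> \<nu> x" "\<nu> 0 = 0"
    and mono: "decseq lam" "incseq \<nu>" and t: "0 \<le> t"
    and modified: "birth_death_process (birth1 lam) (death1 \<nu>) P1 X1"
  defines "V \<equiv> potential1 lam \<nu>"
  shows "ennreal (measure_pmf.prob (law t (x + 1)) {z<..} - measure_pmf.prob (law t x) {z<..})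
    \<le> limsup (\<lambda>n. ennreal ((markov_chain.tilted P1 X1 V (t / real n) ^^ n) (indicator {z}) x))"
proof -
  interpret mod: birth_death_process "birth1 lam" "death1 \<nu>" P1 X1 by (rule modified)
  have V: "0 \<le> V x" for x unfolding V_def by (rule potential1_nonneg[OF mono])
  let ?f = "indicator {z<..} :: nat \<Rightarrow> real"
  have f: "\<bar>?f y\<bar> \<le> 1" for y by (simp add: indicator_def)
  define U where "U s x = measure_pmf.expectation (law s x) ?f" for s x
  have step: "\<bar>U (s + h) x - U s x - h * generator lam \<nu> (U s) x\<bar> \<le> h * (1 * short_time_error x h)"
    if "0 \<le> s" "0 \<le> h" for s h x
    unfolding U_def using that by (rule semigroup_step) (rule f)
  define v where "v n i = (mod.tilted V (t / real n) ^^ i) (indicator {z})" for n i :: nat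
  have v: "v n i y \<in> {0..1}" for n i y
    unfolding v_def using t V by (intro mod.tilted_power_bounds) (auto simp: indicator_def)
  define W where "W n i y = U (real i * (t / real n)) (y + 1) - U (real i * (t / real n)) y - v n i y" for n i :: nat and y
  \<comment> \<open>For \<open>t = 0\<close> the step is \<open>0\<close> and the errors, which are quotients by it, carry no information.\<close>
  define \<eta> where "\<eta> y n = (if t = 0 then 0 else
      short_time_error (y + 1) (t / real n) + short_time_error y (t / real n)
      + (mod.short_time_error y (t / real n)
        + t / real n * (birth1 lam y * V (y + 1) + death1 \<nu> y * V (y - 1))))" for y and n :: nat
  have "\<forall>\<^sub>F n in sequentially. W n n x \<le> e" if e: "0 < e" for e
  proof (rule maximum_principle_refining_steps[where W = W and t = t and M = 2 and c = "lam 0"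
        and b = "\<lambda>x. lam (x + 1)" and d = \<nu> and k = "\<lambda>x. lam x + \<nu> (x + 1)" and \<eta> = \<eta>])
    fix n i y :: nat assume i: "i < n"
    define h s where "h = t / real n" and "s = real i * h"
    have sh: "0 \<le> s" "0 \<le> h" using t by (auto simp: s_def h_def)
    have Suc_i: "real (Suc i) * h = s + h" by (simp add: s_def algebra_simps)
    define D where "D y = U s (y + 1) - U s y - v n i y" for y
    have v_step: "v n i y + h * (generator (birth1 lam) (death1 \<nu>) (v n i) y - V y * v n i y)
        - h * (mod.short_time_error y h + h * (birth1 lam y * V (y + 1) + death1 \<nu> y * V (y - 1)))
        \<le> v n (Suc i) y"
      using mod.tilted_step[where V = V and v = "v n i" and x = y and h = h] sh V v nonneg
      by (simp add: v_def h_def birth1_def death1_def)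
    have "generator lam \<nu> (U s) (y + 1) - generator lam \<nu> (U s) y
        - (generator (birth1 lam) (death1 \<nu>) (v n i) y - V y * v n i y)
      = lam (y + 1) * D (y + 1) + \<nu> y * D (y - 1) - (lam y + \<nu> (y + 1)) * D y"
      using nonneg(3) by (cases y) (simp_all add: generator_def fdiff_def bdiff_def birth1_def death1_def
          V_def potential1_def D_def algebra_simps)
    then have "h * generator lam \<nu> (U s) (y + 1) - h * generator lam \<nu> (U s) y
        - h * (generator (birth1 lam) (death1 \<nu>) (v n i) y - V y * v n i y)
      = h * (lam (y + 1) * D (y + 1) + \<nu> y * D (y - 1) - (lam y + \<nu> (y + 1)) * D y)"
      by (simp only: right_diff_distrib[symmetric])
    then have "U (s + h) (y + 1) - U (s + h) y - v n (Suc i) y \<le> D y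
      + h * (lam (y + 1) * D (y + 1) + \<nu> y * D (y - 1) - (lam y + \<nu> (y + 1)) * D y)
      + (h * short_time_error (y + 1) h + h * short_time_error y h
      + h * (mod.short_time_error y h + h * (birth1 lam y * V (y + 1) + death1 \<nu> y * V (y - 1))))"
      using step[OF sh, of y] step[OF sh, of "y + 1"] v_step
      unfolding D_def mult_1_left by linarith
    also have "h * short_time_error (y + 1) h + h * short_time_error y h
      + h * (mod.short_time_error y h + h * (birth1 lam y * V (y + 1) + death1 \<nu> y * V (y - 1))) = h * \<eta> y n"
      by (simp add: \<eta>_def h_def[symmetric] distrib_left) (simp add: h_def)
    finally show "W n (Suc i) y \<le> W n i y
        + t / real n * (lam (y + 1) * W n i (y + 1) + \<nu> y * W n i (y - 1) - (lam y + \<nu> (y + 1)) * W n i y)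
        + t / real n * \<eta> y n"
      unfolding W_def D_def h_def[symmetric] s_def[symmetric] Suc_i .
  next
    have "\<bar>U s y\<bar> \<le> 1" for s y
      unfolding U_def by (rule abs_expectation_pmf_le) (rule f)
    then show "W n i y \<le> 2" for n i y
      using v[of n i y] unfolding W_def by (smt (verit) atLeastAtMost_iff)
    show "\<eta> y \<longlonglongrightarrow> 0" for y
    proof (cases "t = 0")
      case False
      then have "0 < t" using t by simp
      then have lim: "filterlim (\<lambda>n. t / real n) (at_right 0) sequentially"
        by real_asymp
      have lim0: "(\<lambda>n. t / real n) \<longlonglongrightarrow> 0" by real_asymp
      have "(\<lambda>n. short_time_error (y + 1) (t / real n) + short_time_error y (t / real n)
        + (mod.short_time_error y (t / real n)
        + t / real n * (birth1 lam y * V (y + 1) + death1 \<nu> y * V (y - 1))))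
        \<longlonglongrightarrow> 0 + 0 + (0 + 0 * (birth1 lam y * V (y + 1) + death1 \<nu> y * V (y - 1)))"
        by (intro tendsto_add tendsto_mult tendsto_const lim0
            filterlim_compose[OF short_time_error_tendsto_0 lim]
            filterlim_compose[OF mod.short_time_error_tendsto_0 lim])
      then show ?thesis using False by (simp add: \<eta>_def[abs_def])
    qed (simp add: \<eta>_def[abs_def])
    show "lam (x + 1) + \<nu> x \<le> lam x + \<nu> (x + 1)" for x
      using decseq_SucD[OF mono(1), of x] incseq_SucD[OF mono(2), of x] by simp
    show "lam (x + 1) \<le> lam 0" for x using decseqD[OF mono(1), of 0] by simp
    show "W n 0 y \<le> 0" for n y
      by (auto simp: W_def U_def v_def law_0 indicator_def)
  qed (use nonneg t e in auto)
  note subsolution = this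
  have ev: "\<forall>\<^sub>F n in sequentially. U t (x + 1) - U t x - e \<le> v n n x" if "0 < e" for e
    using subsolution[OF that] eventually_gt_at_top[of 0]
  proof eventually_elim
    case (elim n)
    then show ?case by (simp add: W_def)
  qed
  show ?thesis
  proof (rule ennreal_le_epsilon)
    fix e :: real assume e: "0 < e"
    have lim: "ennreal (U t (x + 1) - U t x - e) \<le> limsup (\<lambda>n. ennreal (v n n x))"
      using ev[OF e] by (intro le_Limsup) (auto elim!: eventually_mono intro: ennreal_leI)
    have "ennreal (U t (x + 1) - U t x) \<le> ennreal (U t (x + 1) - U t x - e) + ennreal e"
    proof (cases "e \<le> U t (x + 1) - U t x")
      case True
      then show ?thesis using e ennreal_plus[of "U t (x + 1) - U t x - e" e] by simp
    next
      case False
      then have "ennreal (U t (x + 1) - U t x) \<le> ennreal e" by (intro ennreal_leI) simp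
      then show ?thesis by (rule add_increasing[OF zero_le])
    qed
    also have "\<dots> \<le> limsup (\<lambda>n. ennreal (v n n x)) + ennreal e"
      using lim by (rule add_right_mono)
    finally show "ennreal (measure_pmf.prob (law t (x + 1)) {z<..} - measure_pmf.prob (law t x) {z<..})
        \<le> limsup (\<lambda>n. ennreal ((mod.tilted V (t / real n) ^^ n) (indicator {z}) x)) + ennreal e"
      unfolding U_def v_def by simp
  qed
qed

end

section \<open>The inequality\<close>

lemma expectation_pmf_nat_sums:
  fixes f :: "nat \<Rightarrow> real"
  assumes "integrable (measure_pmf p) f"
  shows "summable (\<lambda>z. \<bar>pmf p z * f z\<bar>)" "(\<lambda>z. pmf p z * f z) sums measure_pmf.expectation p f"
proof -
  have int: "integrable (count_space UNIV) (\<lambda>z. pmf p z * f z)"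
    using assms unfolding measure_pmf_eq_density by (simp add: integrable_density)
  then show "summable (\<lambda>z. \<bar>pmf p z * f z\<bar>)"
    by (simp add: integrable_count_space_nat_iff)
  show "(\<lambda>z. pmf p z * f z) sums measure_pmf.expectation p f"
    using sums_integral_count_space_nat[OF int]
    by (simp add: measure_pmf_eq_density integral_density)
qed

lemma pmf_eq_tail_difference:
  fixes p :: "nat pmf"
  shows "pmf p z = (if z = 0 then 1 else measure_pmf.prob p {z - 1<..}) - measure_pmf.prob p {z<..}"
proof (cases z)
  case 0
  have "UNIV = {0} \<union> {0 :: nat<..}" by auto
  then have "measure_pmf.prob p UNIV = measure_pmf.prob p {0} + measure_pmf.prob p {0<..}"
    by (subst measure_pmf.finite_measure_Union[symmetric]) auto
  then show ?thesis by (simp add: 0 pmf.rep_eq)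
next
  case (Suc y)
  have "{y<..} = {Suc y} \<union> {Suc y<..}" by auto
  then have "measure_pmf.prob p {y<..} = measure_pmf.prob p {Suc y} + measure_pmf.prob p {Suc y<..}"
    by (subst measure_pmf.finite_measure_Union[symmetric]) auto
  then show ?thesis by (simp add: Suc pmf.rep_eq)
qed

text \<open>
  The weights \<open>q z\<close> on \<open>(z, z + 1)\<close> and \<open>pmf p z - q z\<close> on \<open>(z, z)\<close> form a coupling of \<open>p\<close> and \<open>p'\<close>. Integrating the
  affine minorant of \<open>K\<close> against it returns its value \<open>C\<close> at the means, and the diagonal contributes
  nothing on the right.
\<close>

lemma Jensen_for_unit_step_coupling:
  fixes f :: "nat \<Rightarrow> real" and K :: "real \<Rightarrow> real \<Rightarrow> real" and p p' :: "nat pmf"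
  defines "q \<equiv> \<lambda>z. measure_pmf.prob p' {z<..} - measure_pmf.prob p {z<..}"
    and "m \<equiv> measure_pmf.expectation p f" and "m' \<equiv> measure_pmf.expectation p' f"
  assumes q: "\<And>z. 0 \<le> q z" "\<And>z. q z \<le> pmf p z"
    and int: "integrable (measure_pmf p) f" "integrable (measure_pmf p') f"
    and f: "\<And>z. f z \<in> I"
    and tangent: "\<And>a b. a \<in> I \<Longrightarrow> b \<in> I \<Longrightarrow> C + A * (a - m) + B * (b - m') \<le> K a b"
    and diagonal: "\<And>a. K a a = 0"
  shows "ennreal C \<le> (\<Sum>z. ennreal (q z) * ennreal (K (f z) (f (z + 1))))"
proof -
  \<comment> \<open>The coercion to extended reals cuts \<open>K\<close> off at \<open>0\<close>.\<close>
  define k where "k z = max 0 (K (f z) (f (z + 1)))" for z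
  have k: "ennreal (q z) * ennreal (K (f z) (f (z + 1))) = ennreal (q z * k z)" for z
    using q(1)[of z] by (simp add: k_def ennreal_mult'' max_def ennreal_neg)
  have qk: "0 \<le> q z * k z" for z using q(1) by (simp add: k_def)
  have p': "pmf p' z = pmf p z - q z + (if z = 0 then 0 else q (z - 1))" for z
    unfolding pmf_eq_tail_difference[of p] pmf_eq_tail_difference[of p'] q_def by simp
  have "ennreal C \<le> (\<Sum>z. ennreal (q z * k z))"
  proof (cases "summable (\<lambda>z. q z * k z)")
    case False
    then have "(\<Sum>z. ennreal (q z * k z)) = top"
      using summable_suminf_not_top[of "\<lambda>z. q z * k z", OF qk] by argo
    then show ?thesis by simp
  next
    case True
    have "summable (\<lambda>z. (pmf p z - q z) * f z)"
    proof (rule summable_comparison_test'[OF expectation_pmf_nat_sums(1)[OF int(1)]])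
      show "norm ((pmf p z - q z) * f z) \<le> \<bar>pmf p z * f z\<bar>" for z
        using q[of z] by (auto simp: abs_mult intro!: mult_right_mono)
    qed
    moreover define s1 where "s1 = (\<Sum>z. (pmf p z - q z) * f z)"
    ultimately have s1: "(\<lambda>z. (pmf p z - q z) * f z) sums s1" by (simp add: summable_sums)
    have "summable (\<lambda>z. q z * f (z + 1))"
    proof (rule summable_comparison_test')
      show "summable (\<lambda>z. \<bar>pmf p' (Suc z) * f (Suc z)\<bar>)"
        using expectation_pmf_nat_sums(1)[OF int(2)] by (subst summable_Suc_iff)
      show "norm (q z * f (z + 1)) \<le> \<bar>pmf p' (Suc z) * f (Suc z)\<bar>" for z
        using q[of z] q[of "Suc z"] p'[of "Suc z"] by (auto simp: abs_mult intro!: mult_right_mono)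
    qed
    moreover define s2 where "s2 = (\<Sum>z. q z * f (z + 1))"
    ultimately have s2: "(\<lambda>z. q z * f (z + 1)) sums s2" by (simp add: summable_sums)
    have "(\<lambda>z. case z of 0 \<Rightarrow> 0 | Suc y \<Rightarrow> q y * f (Suc y)) sums (s2 + 0)"
      using sums_Suc[of "\<lambda>z. case z of 0 \<Rightarrow> 0 | Suc y \<Rightarrow> q y * f (Suc y)" s2] s2 by simp
    then have "(\<lambda>z. (pmf p z - q z) * f z + (case z of 0 \<Rightarrow> 0 | Suc y \<Rightarrow> q y * f (Suc y))) sums (s1 + (s2 + 0))"
      by (intro sums_add s1)
    moreover have "(pmf p z - q z) * f z + (case z of 0 \<Rightarrow> 0 | Suc y \<Rightarrow> q y * f (Suc y)) = pmf p' z * f z" for z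
      by (cases z) (simp_all add: p' algebra_simps)
    ultimately have m': "s1 + s2 = m'"
      using expectation_pmf_nat_sums(2)[OF int(2)] by (simp add: m'_def sums_unique2)
    have sum_p: "pmf p sums 1"
      using expectation_pmf_nat_sums(2)[of p "\<lambda>_. 1"] by simp
    have "(\<lambda>z. C * pmf p z + A * (pmf p z * f z - m * pmf p z)
        + B * (((pmf p z - q z) * f z + q z * f (z + 1)) - m' * pmf p z))
      sums (C * 1 + A * (m - m * 1) + B * ((s1 + s2) - m' * 1))"
      using expectation_pmf_nat_sums(2)[OF int(1)]
      by (intro sums_add sums_mult sums_diff s1 s2 sum_p) (simp add: m_def)
    then have "(\<lambda>z. C * pmf p z + A * (pmf p z * f z - m * pmf p z)
        + B * (((pmf p z - q z) * f z + q z * f (z + 1)) - m' * pmf p z)) sums C"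
      by (simp add: m')
    then have "C \<le> (\<Sum>z. q z * k z)"
    proof (rule sums_le[rotated, OF _ summable_sums[OF True]])
      fix z
      have "C * pmf p z + A * (pmf p z * f z - m * pmf p z)
          + B * (((pmf p z - q z) * f z + q z * f (z + 1)) - m' * pmf p z)
        = (pmf p z - q z) * (C + A * (f z - m) + B * (f z - m'))
          + q z * (C + A * (f z - m) + B * (f (z + 1) - m'))"
        by (simp add: algebra_simps)
      also have "\<dots> \<le> (pmf p z - q z) * 0 + q z * k z"
        using q[of z] tangent[OF f f, of z z] tangent[OF f f, of z "z + 1"] diagonal[of "f z"]
        by (intro add_mono mult_left_mono) (auto simp: k_def)
      finally show "C * pmf p z + A * (pmf p z * f z - m * pmf p z)
          + B * (((pmf p z - q z) * f z + q z * f (z + 1)) - m' * pmf p z) \<le> q z * k z"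
        by simp
    qed
    then have "ennreal C \<le> ennreal (\<Sum>z. q z * k z)" by (rule ennreal_leI)
    also have "\<dots> = (\<Sum>z. ennreal (q z * k z))"
      using True qk by (intro suminf_ennreal2[symmetric])
    finally show ?thesis .
  qed
  then show ?thesis by (simp only: k)
qed

theorem theorem2p7:
  fixes lam \<nu> :: "nat \<Rightarrow> real"
    and P :: "nat \<Rightarrow> 'a measure" and X :: "real \<Rightarrow> 'a \<Rightarrow> nat"
    and P1 :: "nat \<Rightarrow> 'b measure" and X1 :: "real \<Rightarrow> 'b \<Rightarrow> nat"
    and I :: "real set" and \<phi> :: "real \<Rightarrow> real"
    and f :: "nat \<Rightarrow> real" and t :: real
  assumes "irreducible_rates lam \<nu>"
    and "nonexplosive_rates lam \<nu>"
    and "birth_death_process lam \<nu> P X"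
    and "birth_death_process (birth1 lam) (death1 \<nu>) P1 X1"
    and "\<And>x s. s \<ge> 0 \<Longrightarrow>
           (\<integral>\<^sup>+\<omega>. ennreal (birth1 lam (X1 s \<omega>) + death1 \<nu> (X1 s \<omega>) + \<bar>potential1 lam \<nu> (X1 s \<omega>)\<bar>) \<partial>P1 x) < \<infinity>"
    and "open I" and "is_interval I"
    and "smooth_on I \<phi>" and "convex_on I \<phi>"
    and "\<And>r. r \<in> I \<Longrightarrow> deriv (deriv \<phi>) r > 0"
    and "convex_on I (\<lambda>r. - 1 / deriv (deriv \<phi>) r)"
    and "decseq lam" and "incseq \<nu>"
    and "\<And>y. f y \<in> I"
    and "bdd_above (range (\<lambda>y. \<bar>fdiff f y\<bar>))"
    and "t \<ge> 0"
  shows "\<forall>x. ennreal (B_fun \<phi> (semigroup_of P X t f x) (fdiff (semigroup_of P X t f) x))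
           \<le> feynman_kac P1 X1 (potential1 lam \<nu>) t (\<lambda>y. ennreal (B_fun \<phi> (f y) (fdiff f y))) x"
proof
  fix x
  interpret birth_death_process lam \<nu> P X by fact
  interpret mod: birth_death_process "birth1 lam" "death1 \<nu>" P1 X1 by fact
  have rates: "0 \<le> lam z" "0 \<le> \<nu> z" "\<nu> 0 = 0" for z
    using assms(1) by (cases "z = 0"; force simp: irreducible_rates_def intro: less_imp_le)+
  let ?V = "potential1 lam \<nu>"
  have V: "0 \<le> ?V z" for z using assms(12,13) by (rule potential1_nonneg)
  obtain C where C: "\<And>y. \<bar>fdiff f y\<bar> \<le> C"
    using assms(15) by (auto simp: bdd_above_def)
  have int: "integrable (law t y) f" for y
    by (rule integrable_law_Lipschitz[OF rates(1,2) assms(12,16) C])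
  define u where "u y = measure_pmf.expectation (law t y) f" for y
  have u: "semigroup_of P X t f = u"
    using assms(16) by (auto simp: u_def semigroup_eq_expectation_law)
  have uI: "u y \<in> I" for y
    unfolding u_def using assms(14)
    by (intro measure_pmf.expectation_in_open_interval assms(6,7) int) auto
  define q where "q z = measure_pmf.prob (law t (x + 1)) {z<..} - measure_pmf.prob (law t x) {z<..}" for z
  have q_nonneg: "0 \<le> q z" for z
    using expectation_mono_start[where f = "indicator {z<..}" and M = 1 and t = t and x = x, OF rates assms(12,13)] assms(16)
    by (simp add: q_def incseq_def indicator_def)
  have q_le: "q z \<le> pmf (law t x) z" for z
  proof -
    have "measure_pmf.expectation (law t (x + 1)) (indicator {z<..})
        \<le> measure_pmf.expectation (law t x) (indicator {z..} :: nat \<Rightarrow> real)"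
      using assms(16)
      by (intro expectation_shift_start[where M = 1, OF rates assms(12,13)]) (auto simp: incseq_def indicator_def)
    moreover have "measure_pmf.prob (law t x) {z..} = measure_pmf.prob (law t x) {z} + measure_pmf.prob (law t x) {z<..}"
    proof (subst measure_pmf.finite_measure_Union[symmetric])
      show "measure_pmf.prob (law t x) {z..} = measure_pmf.prob (law t x) ({z} \<union> {z<..})"
        by (rule arg_cong[where f = "measure_pmf.prob (law t x)"]) auto
    qed auto
    ultimately show ?thesis by (simp add: q_def pmf.rep_eq)
  qed
  define F G H where "F = deriv \<phi>" and "G = deriv F" and "H = deriv G"
  have smooth: "(deriv ^^ n) \<phi> differentiable (at r)" if "r \<in> I" for n r
    using assms(8) that by (auto simp: smooth_on_def)
  have F: "(F has_real_derivative G r) (at r)" and G: "(G has_real_derivative H r) (at r)" if "r \<in> I" for r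
    using smooth[OF that, of 1] smooth[OF that, of 2]
    by (simp_all add: F_def G_def H_def DERIV_deriv_iff_real_differentiable numeral_2_eq_2)
  have pos: "0 < G r" if "r \<in> I" for r
    using assms(10)[OF that] by (simp add: F_def G_def)
  have conv: "convex_on I (\<lambda>r. - 1 / G r)"
    using assms(11) by (simp add: F_def G_def)
  define K where "K a b = (F b - F a) * (b - a)" for a b
  define a0 b0 where "a0 = u x" and "b0 = u (x + 1)"
  have tangent: "K a0 b0 + (- (G a0 * (b0 - a0) + (F b0 - F a0))) * (a - a0)
      + (G b0 * (b0 - a0) + (F b0 - F a0)) * (b - b0) \<le> K a b" if "a \<in> I" "b \<in> I" for a b
    unfolding K_def a0_def b0_def
    using increment_product_above_tangent[OF assms(6,7) F G pos conv uI[of x] uI[of "x + 1"] that]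
    by (simp only: mult_minus_left add_uminus_conv_diff)
  have "ennreal (K a0 b0) \<le> (\<Sum>z. ennreal (q z) * ennreal (K (f z) (f (z + 1))))"
    unfolding q_def
    by (rule Jensen_for_unit_step_coupling[OF _ _ int int assms(14)])
       (use q_nonneg q_le tangent in \<open>simp_all add: q_def a0_def b0_def u_def K_def\<close>)
  also have "\<dots> \<le> (\<Sum>z. ennreal (K (f z) (f (z + 1)))
      * limsup (\<lambda>n. ennreal ((mod.tilted ?V (t / real n) ^^ n) (indicator {z}) x)))"
  proof (rule suminf_le)
    fix z
    have "ennreal (q z) \<le> limsup (\<lambda>n. ennreal ((mod.tilted ?V (t / real n) ^^ n) (indicator {z}) x))"
      unfolding q_def by (rule tail_increment_le_product_limit[OF rates assms(12,13,16,4)])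
    then show "ennreal (q z) * ennreal (K (f z) (f (z + 1))) \<le> ennreal (K (f z) (f (z + 1)))
      * limsup (\<lambda>n. ennreal ((mod.tilted ?V (t / real n) ^^ n) (indicator {z}) x))"
      by (subst mult.commute) (rule mult_left_mono, auto)
  qed auto
  also have "\<dots> \<le> feynman_kac P1 X1 ?V t (\<lambda>z. ennreal (K (f z) (f (z + 1)))) x"
    by (rule mod.feynman_kac_ge_product_limit[OF assms(16) V])
  finally show "ennreal (B_fun \<phi> (semigroup_of P X t f x) (fdiff (semigroup_of P X t f) x))
      \<le> feynman_kac P1 X1 ?V t (\<lambda>y. ennreal (B_fun \<phi> (f y) (fdiff f y))) x"
    unfolding u by (simp add: K_def B_fun_def fdiff_def F_def a0_def b0_def)
qed

end
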